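(* Let $K$ be an infinite compact subset of $\mathbb{C}$. Then $K$ is a uniqueness set if and only if $K$ is not a Julia-like set and $K$ is not invariant under any non-trivial rotation of $\mathbb{C}$.
   Context: A compact set $K\subset\mathbb{C}$ is a uniqueness set (for polynomials) if for every pair of non-constant polynomials $f,g$ in one complex variable, $f^{-1}(K)=g^{-1}(K)$ implies $f=g$. A compact set $K\subset\mathbb{C}$ is a Julia-like set ("ensemble d'allure Julia") if $K$ contains at least two points and there is a polynomial $P$ of degree $\deg(P)\ge2$ such that $P^{-1}(K)=K$. A rotation is a map $z\mapsto c+e^{i\theta}(z-c)$ with $c\in\mathbb{C}$, $\theta\in\mathbb{R}$; it is non-trivial if it is not the identity. *)

theory Defs
  imports "HOL-Analysis.Analysis" "HOL-Computational_Algebra.Polynomial"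
begin

definition uniqueness_set :: "complex set \<Rightarrow> bool" where
  "uniqueness_set K \<longleftrightarrow> compact K \<and>
     (\<forall>f g :: complex poly. degree f > 0 \<longrightarrow> degree g > 0 \<longrightarrow>
        poly f -` K = poly g -` K \<longrightarrow> f = g)"

definition julia_like :: "complex set \<Rightarrow> bool" where
  "julia_like K \<longleftrightarrow> compact K \<and> (\<exists>x\<in>K. \<exists>y\<in>K. x \<noteq> y) \<and>
     (\<exists>P :: complex poly. degree P \<ge> 2 \<and> poly P -` K = K)"

definition is_rotation :: "(complex \<Rightarrow> complex) \<Rightarrow> bool" where
  "is_rotation R \<longleftrightarrow>
     (\<exists>(c :: complex) (\<theta> :: real). R = (\<lambda>z. c + exp (\<i> * complex_of_real \<theta>) * (z - c)))"

end

theory Submission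
  imports Defs "HOL-Computational_Algebra.Fundamental_Theorem_Algebra"
begin

text \<open>Call \<open>K\<close> saturated for \<open>p\<close> if it is a union of fibres of \<open>p\<close>. Suppose \<open>f\<^sup>-\<^sup>1(K) = g\<^sup>-\<^sup>1(K) =
  E\<close>. Averaging a Chebyshev polynomial of \<open>E\<close> over the fibres of \<open>f\<close>, or of \<open>g\<close>, does not increase
  its maximum on \<open>E\<close>, so by uniqueness it is a polynomial in \<open>f\<close> and also one in \<open>g\<close>. Hence \<open>A \<circ> f
  = B \<circ> g\<close> with \<open>A\<close>, \<open>B\<close> of coprime degrees, and \<open>K = A\<^sup>-\<^sup>1(L) = B\<^sup>-\<^sup>1(L)\<close> for some \<open>L\<close>. If \<open>A\<close> or \<open>B\<close> is
  affine, then \<open>K\<close> is Julia-like or rotation invariant. Otherwise, repeating the construction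
  with \<open>L\<close> in place of \<open>K\<close> shows that \<open>K\<close> is saturated for polynomials of degrees \<open>n\<^sup>k\<close> and \<open>m\<^sup>k\<close> for
  all \<open>k\<close>, where \<open>n\<close> and \<open>m\<close> are the coprime degrees. Counting ramification points of a common
  composite in which one degree is much larger than the other, these polynomials are powers
  or Chebyshev polynomials up to affine maps. A power makes \<open>K\<close> rotation invariant. In the
  Chebyshev case all those of degree \<open>n\<^sup>k\<close> have the same normalization, so in the coordinate \<open>z
  = c + d cos t\<close> the set \<open>K\<close> is invariant under \<open>t \<mapsto> t + 2\<pi>/n\<^sup>k\<close> for all \<open>k\<close>, hence under \<open>t \<mapsto> t +
  \<pi>\<close>, which is the half turn about \<open>c\<close>.\<close>

section \<open>Multiplicities\<close>

text \<open>The ramification index of \<open>p\<close> at \<open>x\<close>. It is meaningful for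
  nonconstant \<open>p\<close>; for a constant, \<open>order\<close> is applied to the zero
  polynomial.\<close>

definition pmult :: "complex poly \<Rightarrow> complex \<Rightarrow> nat" where
  "pmult p x = order x (p - [:poly p x:])"

lemma degree_diff_const [simp]:
  fixes p :: "complex poly"
  assumes "degree p > 0"
  shows "degree (p - [:u:]) = degree p"
  using assms by (metis degree_add_eq_left degree_minus degree_pCons_0 diff_conv_add_uminus)

lemma neq_const_poly [simp]: "degree p > 0 \<Longrightarrow> p \<noteq> [:u:]"
  by auto

lemma finite_fibre:
  fixes p :: "complex poly"
  assumes "degree p > 0"
  shows "finite {x. poly p x = u}"
proof -
  have "p - [:u:] \<noteq> 0" using assms by simp
  then have "finite {x. poly (p - [:u:]) x = 0}" by (rule poly_roots_finite)
  then show ?thesis by simp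
qed

lemma poly_surj:
  fixes p :: "complex poly"
  assumes "degree p > 0"
  obtains x where "poly p x = u"
proof -
  have "degree (p - [:u:]) > 0" using assms by simp
  then obtain x where "poly (p - [:u:]) x = 0"
    using alg_closed_imp_poly_has_root by blast
  with that show ?thesis by simp
qed

lemma sum_order_roots:
  fixes p :: "complex poly"
  assumes "p \<noteq> 0"
  shows "(\<Sum>x | poly p x = 0. order x p) = degree p"
  using size_proots_complex[of p] assms by (simp add: size_multiset_overloaded_eq)

lemma sum_order_le:
  fixes p :: "complex poly"
  assumes "p \<noteq> 0" "finite S"
  shows "(\<Sum>x\<in>S. order x p) \<le> degree p"
proof -
  have "(\<Sum>x\<in>S. order x p) = (\<Sum>x\<in>S \<inter> {x. poly p x = 0}. order x p)"
    using assms by (intro sum.mono_neutral_right) (auto simp: order_root)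
  also have "\<dots> \<le> (\<Sum>x | poly p x = 0. order x p)"
    using assms poly_roots_finite by (intro sum_mono2) auto
  finally show ?thesis using sum_order_roots[OF assms(1)] by simp
qed

lemma pmult_pderiv:
  assumes "degree p > 0"
  shows "pmult p x = Suc (order x (pderiv p))"
proof -
  have "p - [:poly p x:] \<noteq> 0" using assms by simp
  then show ?thesis
    unfolding pmult_def by (subst order_pderiv) (auto simp: pderiv_diff pderiv_pCons)
qed

lemma pmult_pos: "degree p > 0 \<Longrightarrow> pmult p x > 0"
  by (simp add: pmult_pderiv)

lemma sum_pmult_fibre:
  assumes "degree p > 0"
  shows "(\<Sum>x | poly p x = u. pmult p x) = degree p"
proof -
  have "(\<Sum>x | poly p x = u. pmult p x) = (\<Sum>x | poly (p - [:u:]) x = 0. order x (p - [:u:]))"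
    by (intro sum.cong) (auto simp: pmult_def)
  also have "\<dots> = degree p"
    using assms by (subst sum_order_roots) auto
  finally show ?thesis .
qed

lemma pmult_le_degree:
  assumes "degree p > 0"
  shows "pmult p x \<le> degree p"
  using member_le_sum[of x "{y. poly p y = poly p x}" "pmult p"]
    finite_fibre[OF assms] sum_pmult_fibre[OF assms] by simp

lemma sum_ramification_le:
  assumes "degree p > 0" "finite S"
  shows "(\<Sum>x\<in>S. pmult p x - 1) \<le> degree p - 1"
proof -
  have "pderiv p \<noteq> 0" using assms by (auto simp: pderiv_eq_0_iff)
  from sum_order_le[OF this assms(2)] show ?thesis
    using assms by (simp add: pmult_pderiv degree_pderiv)
qed

lemma finite_critical:
  assumes "degree p > 0"
  shows "finite {x. pmult p x > 1}"
proof -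
  have "pderiv p \<noteq> 0" using assms by (auto simp: pderiv_eq_0_iff)
  then show ?thesis
    using assms poly_roots_finite[of "pderiv p"] by (simp add: pmult_pderiv order_gt_0_iff)
qed

text \<open>The Riemann-Hurwitz count for polynomials: \<open>pmult p x - 1\<close> is the order of
  \<open>pderiv p\<close> at \<open>x\<close>, and these orders add up to
  \<open>degree p - 1\<close>.\<close>

lemma sum_ramification:
  assumes "degree p > 0" "finite S" "{x. pmult p x > 1} \<subseteq> S"
  shows "(\<Sum>x\<in>S. pmult p x - 1) = degree p - 1"
proof -
  have nz: "pderiv p \<noteq> 0" using assms by (auto simp: pderiv_eq_0_iff)
  have "(\<Sum>x\<in>S. pmult p x - 1) = (\<Sum>x | poly (pderiv p) x = 0. order x (pderiv p))"
    using assms nz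
    by (intro sum.mono_neutral_cong_right) (auto simp: pmult_pderiv order_root poly_roots_finite)
  also have "\<dots> = degree p - 1"
    using nz by (subst sum_order_roots) (auto simp: degree_pderiv)
  finally show ?thesis .
qed

section \<open>Orders of vanishing under composition\<close>

lemma order_power_poly:
  fixes p :: "complex poly"
  assumes "p \<noteq> 0"
  shows "order x (p ^ k) = k * order x p"
  using assms by (induction k) (auto simp: order_mult)

text \<open>Write \<open>q = (X - b) ^ k * r\<close> with \<open>b = poly f x\<close> and
  \<open>r\<close> nonzero at \<open>b\<close>; after composition only the factor
  \<open>(f - b) ^ k\<close> vanishes at \<open>x\<close>.\<close>

lemma order_pcompose:
  fixes q f :: "complex poly"
  assumes "degree f > 0" "q \<noteq> 0"
  shows "order x (pcompose q f) = order (poly f x) q * pmult f x"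
proof -
  define b where "b = poly f x"
  obtain r where r: "q = [:-b, 1:] ^ order b q * r" "\<not> [:-b, 1:] dvd r"
    using order_decomp[OF assms(2)] by blast
  have pow: "pcompose ([:-b, 1:] ^ k) f = (f - [:b:]) ^ k" for k
    by (induction k) (simp_all add: pcompose_mult pcompose_pCons pcompose_1 del: mult_pCons_left)
  have comp: "pcompose q f = (f - [:b:]) ^ order b q * pcompose r f"
    by (subst r(1)) (simp only: pcompose_mult pow)
  have "poly (pcompose r f) x \<noteq> 0"
    using r(2) by (simp add: poly_pcompose b_def poly_eq_0_iff_dvd)
  moreover have "f - [:b:] \<noteq> 0" using assms by simp
  ultimately show ?thesis
    unfolding comp by (subst order_mult) (auto simp: order_power_poly order_0I b_def pmult_def)
qed

lemma pmult_pcompose: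
  assumes "degree f > 0" "degree A > 0"
  shows "pmult (pcompose A f) x = pmult A (poly f x) * pmult f x"
proof -
  have "A - [:poly A (poly f x):] \<noteq> 0" using assms by simp
  then show ?thesis
    using order_pcompose[OF assms(1), of "A - [:poly A (poly f x):]" x]
    by (simp add: pmult_def pcompose_diff poly_pcompose)
qed

section \<open>Norms along a polynomial\<close>

text \<open>Induction on the degree bound: dividing by \<open>X - y\<close> at a good point
  \<open>y\<close> leaves a quotient family of lower degree. Its value at \<open>z\<close> is
  obtained by dividing by \<open>z - y\<close>, so a finite set \<open>S\<close> of exceptional
  points is carried along.\<close>

lemma coeff_polynomial_family:
  fixes c :: "complex \<Rightarrow> complex poly"
  assumes "\<And>u. degree (c u) \<le> n" "finite S"
    and "\<And>y. y \<notin> S \<Longrightarrow> \<exists>P. \<forall>u. poly (c u) y = poly P u"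
  shows "\<exists>P. \<forall>u. coeff (c u) i = poly P u"
  using assms
proof (induction n arbitrary: c S i)
  case 0
  obtain y where "y \<notin> S" using ex_new_if_finite[OF infinite_UNIV_char_0 0(2)] by blast
  then obtain P where P: "\<forall>u. poly (c u) y = poly P u" using 0 by blast
  have c: "c u = [:coeff (c u) 0:]" for u
    using 0(1)[of u] degree_eq_zeroE[of "c u"] by fastforce
  have "coeff (c u) 0 = poly P u" for u
    using P c[of u] by (metis mult_zero_right poly_0 poly_pCons add.right_neutral)
  moreover have "coeff (c u) i = 0" if "i > 0" for u
    using that 0(1)[of u] by (simp add: coeff_eq_0)
  ultimately show ?case
    by (cases "i = 0") (auto intro: exI[of _ 0])
next
  case (Suc n)
  obtain y where y: "y \<notin> S" using ex_new_if_finite[OF infinite_UNIV_char_0 Suc.prems(2)] by blast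
  then obtain P where P: "\<And>u. poly (c u) y = poly P u" using Suc.prems(3) by blast
  define d where "d u = synthetic_div (c u) y" for u
  have eq: "c u = [:-y, 1:] * d u + [:poly P u:]" for u
    using synthetic_div_correct'[of y "c u"] P by (simp add: d_def)
  have "\<exists>Q. \<forall>u. coeff (d u) j = poly Q u" for j
  proof (rule Suc.IH)
    show "degree (d u) \<le> n" for u using Suc.prems(1)[of u] by (simp add: d_def degree_synthetic_div)
    show "finite (insert y S)" using Suc by simp
    show "\<exists>P. \<forall>u. poly (d u) z = poly P u" if "z \<notin> insert y S" for z
    proof -
      have "z \<notin> S" using that by blast
      then obtain Q where Q: "\<And>u. poly (c u) z = poly Q u" using Suc.prems(3) by blast
      have "poly (d u) z = poly (smult (1 / (z - y)) (Q - P)) u" for u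
        using that arg_cong[OF eq[of u], of "\<lambda>p. poly p z"] by (simp add: Q field_simps)
      then show ?thesis by blast
    qed
  qed
  then obtain Q where Q: "\<And>u j. coeff (d u) j = poly (Q j) u" by metis
  have "coeff (c u) i = poly ((case i of 0 \<Rightarrow> P | Suc j \<Rightarrow> Q j) - smult y (Q i)) u" for u
    by (subst eq) (auto simp: Q coeff_pCons split: nat.split)
  then show ?case by blast
qed

text \<open>The norm of \<open>Y - g\<close> along \<open>f\<close>, that is, the characteristic
  polynomial of multiplication by \<open>g\<close> modulo \<open>f - u\<close>. The multiset of
  roots keeps its degree constant in \<open>u\<close>, also over critical values.\<close>

definition fibre_prod :: "complex poly \<Rightarrow> complex poly \<Rightarrow> complex \<Rightarrow> complex poly" where
  "fibre_prod f g u = (\<Prod>x\<in>#proots (f - [:u:]). [:- poly g x, 1:])"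

lemma size_proots_diff_const:
  fixes f :: "complex poly"
  assumes "degree f > 0"
  shows "size (proots (f - [:u:])) = degree f"
  using degree_diff_const[OF assms] size_proots_complex by metis

lemma degree_prod_mset_linear:
  "degree (\<Prod>x\<in>#X. [:- h x, 1:]) = size X" for h :: "complex \<Rightarrow> complex"
proof (induction X)
  case (add x X)
  have "(\<Prod>x\<in>#X. [:- h x, 1:]) \<noteq> 0" by (auto simp: prod_mset_zero_iff)
  then show ?case using add by (simp add: degree_mult_eq del: mult_pCons_left)
qed simp

lemma lead_coeff_prod_mset_linear:
  "lead_coeff (\<Prod>x\<in>#X. [:- h x, 1:]) = 1" for h :: "complex \<Rightarrow> complex"
  by (induction X) (auto simp: lead_coeff_mult simp del: mult_pCons_left)

lemma degree_fibre_prod: "degree f > 0 \<Longrightarrow> degree (fibre_prod f g u) = degree f"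
  by (simp add: fibre_prod_def degree_prod_mset_linear size_proots_complex)

lemma lead_coeff_fibre_prod: "lead_coeff (fibre_prod f g u) = 1"
  unfolding fibre_prod_def by (rule lead_coeff_prod_mset_linear)

text \<open>Symmetry of the resultant: the product of \<open>h x\<close> over \<open>f x = u\<close> becomes the product of
  \<open>f z - u\<close> over \<open>h z = 0\<close>.\<close>

lemma prod_over_fibre_polynomial:
  fixes f h :: "complex poly"
  assumes "degree f > 0"
  shows "\<exists>P. \<forall>u. (\<Prod>x\<in>#proots (f - [:u:]). poly h x) = poly P u"
proof (cases "h = 0")
  case True
  have "(\<Prod>x\<in>#proots (f - [:u:]). poly h x) = 0" for u
  proof -
    obtain x where "poly f x = u" using poly_surj[OF assms] by blast
    moreover have "f - [:u:] \<noteq> 0" using assms by simp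
    ultimately have "x \<in># proots (f - [:u:])" by simp
    then have "0 \<in># {#poly h x. x \<in># proots (f - [:u:])#}" using True by force
    then show ?thesis using prod_mset_zero_iff by blast
  qed
  then show ?thesis by (intro exI[of _ 0]) auto
next
  case False
  define a where "a = degree f"
  define l where "l = lead_coeff h"
  define Z where "Z = proots h"
  have l: "lead_coeff f \<noteq> 0" using assms by auto
  have fz: "(\<Prod>x\<in>#proots (f - [:u:]). x - z) = (-1) ^ a / lead_coeff f * (poly f z - u)" for z u
  proof -
    have "lead_coeff (f - [:u:]) = lead_coeff f"
      using assms by (cases "degree f") (auto simp: coeff_pCons)
    then have "poly f z - u = lead_coeff f * (\<Prod>x\<in>#proots (f - [:u:]). z - x)"
      using arg_cong[OF complex_poly_decompose_multiset[of "f - [:u:]"], of "\<lambda>p. poly p z"]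
      by (simp add: poly_prod_mset)
    moreover have "(\<Prod>x\<in>#X. z - x) = (-1) ^ size X * (\<Prod>x\<in>#X. x - z)" for X
      by (induction X) (auto simp: algebra_simps)
    ultimately show ?thesis
      using l by (simp add: size_proots_diff_const[OF assms] a_def flip: power_mult_distrib)
  qed
  have "(\<Prod>x\<in>#proots (f - [:u:]). poly h x)
      = poly (smult (l ^ a) (\<Prod>z\<in>#Z. smult ((-1) ^ a / lead_coeff f) [:poly f z, -1:])) u" for u
  proof -
    have "(\<Prod>x\<in>#X. poly h x) = l ^ size X * (\<Prod>x\<in>#X. \<Prod>z\<in>#Z. x - z)" for X
    proof (induction X)
      case (add x X)
      have "poly h x = l * (\<Prod>z\<in>#Z. x - z)"
        using arg_cong[OF complex_poly_decompose_multiset[of h], of "\<lambda>p. poly p x"]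
        by (simp add: poly_prod_mset l_def Z_def)
      then show ?case using add by simp
    qed auto
    also have "(\<Prod>x\<in>#proots (f - [:u:]). \<Prod>z\<in>#Z. x - z)
        = (\<Prod>z\<in>#Z. \<Prod>x\<in>#proots (f - [:u:]). x - z)"
      by (rule prod_mset.swap)
    finally show ?thesis
      by (simp add: fz size_proots_diff_const[OF assms] a_def poly_prod_mset right_diff_distrib
          mult.commute[of u])
  qed
  then show ?thesis by blast
qed

text \<open>For fixed \<open>y\<close> the value at \<open>y\<close> is the fibre product of
  \<open>[:y:] - g\<close>, which is polynomial in \<open>u\<close>; interpolation in
  \<open>y\<close> carries this over to the coefficients.\<close>

lemma fibre_prod_polynomial:
  assumes "degree f > 0"
  obtains C :: "complex poly poly"
    where "degree C = degree f" "lead_coeff C = 1" "\<And>u. map_poly (\<lambda>c. poly c u) C = fibre_prod f g u"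
proof -
  have "\<exists>P. \<forall>u. coeff (fibre_prod f g u) i = poly P u" for i
  proof (rule coeff_polynomial_family[where n = "degree f" and S = "{}"])
    show "\<exists>P. \<forall>u. poly (fibre_prod f g u) y = poly P u" for y
      using prod_over_fibre_polynomial[OF assms, of "[:y:] - g"]
      by (simp add: fibre_prod_def poly_prod_mset algebra_simps)
  qed (simp_all add: degree_fibre_prod assms)
  then obtain P where P: "\<And>u i. coeff (fibre_prod f g u) i = poly (P i) u" by metis
  define C where "C = (\<Sum>i\<le>degree f. monom (P i) i)"
  have C: "coeff C i = (if i \<le> degree f then P i else 0)" for i
    by (simp add: C_def coeff_sum)
  have "poly (P (degree f)) u = poly 1 u" for u
    using lead_coeff_fibre_prod[of f g u] by (simp add: degree_fibre_prod assms P)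
  then have top: "P (degree f) = 1" by (simp add: fun_eq_iff flip: poly_eq_poly_eq_iff)
  have deg: "degree C = degree f"
    using C top by (intro antisym degree_le le_degree) auto
  show thesis
  proof
    show "map_poly (\<lambda>c. poly c u) C = fibre_prod f g u" for u
      by (rule poly_eqI) 
        (auto simp: coeff_map_poly C P[symmetric] coeff_eq_0 degree_fibre_prod assms)
  qed (use deg top C in auto)
qed

section \<open>Averages over fibres\<close>

lemma coeff_prod_mset_linear:
  fixes h :: "complex \<Rightarrow> complex"
  assumes "size X = Suc n"
  shows "coeff (\<Prod>x\<in>#X. [:- h x, 1:]) n = - (\<Sum>x\<in>#X. h x)"
  using assms
proof (induction n arbitrary: X)
  case 0
  then obtain x where "X = {#x#}" using size_1_singleton_mset[of X] by auto
  then show ?case by simp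
next
  case (Suc n)
  then obtain x Y where X: "X = add_mset x Y" and Y: "size Y = Suc n"
    by (metis size_eq_Suc_imp_eq_union add_mset_add_single size_add_mset nat.inject)
  let ?Q = "\<Prod>x\<in>#Y. [:- h x, 1:]"
  have "coeff ?Q (Suc n) = 1"
    using lead_coeff_prod_mset_linear[of h Y] degree_prod_mset_linear[of h Y] Y by simp
  moreover have "coeff ?Q n = - (\<Sum>x\<in>#Y. h x)" using Suc.IH Y by simp
  ultimately show ?case by (simp add: X)
qed

text \<open>The sum is minus the second highest coefficient of \<open>fibre_prod f T u\<close>, and
  so depends polynomially on \<open>u\<close>.\<close>

lemma sum_over_fibre_polynomial:
  fixes f T :: "complex poly"
  assumes "degree f > 0"
  obtains S where "\<And>u. poly S u = (\<Sum>x\<in>#proots (f - [:u:]). poly T x)"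
proof -
  obtain n where n: "degree f = Suc n" using assms gr0_implies_Suc by blast
  obtain C where C: "\<And>u. map_poly (\<lambda>c. poly c u) C = fibre_prod f T u"
    using fibre_prod_polynomial[OF assms] by metis
  have "poly (- coeff C n) u = (\<Sum>x\<in>#proots (f - [:u:]). poly T x)" for u
  proof -
    have "coeff (fibre_prod f T u) n = - (\<Sum>x\<in>#proots (f - [:u:]). poly T x)"
      unfolding fibre_prod_def
      using size_proots_diff_const[OF assms] n by (intro coeff_prod_mset_linear) simp
    then show ?thesis by (simp flip: C add: coeff_map_poly)
  qed
  then show thesis using that by blast
qed

section \<open>Growth of fibre sums at infinity\<close>

lemma degree_less_of_tendsto_0:
  fixes R :: "complex poly"
  assumes lim: "((\<lambda>x. poly R x / x ^ M) \<longlongrightarrow> 0) at_infinity" and "R \<noteq> 0"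
  shows "degree R < M"
proof (rule ccontr)
  assume "\<not> degree R < M"
  then obtain k where k: "degree R = M + k" by (metis le_Suc_ex not_less)
  have "((\<lambda>x::complex. 1 / x ^ k) \<longlongrightarrow> (if k = 0 then 1 else 0)) at_infinity"
    by (auto intro!: tendsto_divide_0 filterlim_power_at_infinity)
  then have "((\<lambda>x. poly R x / x ^ M * (1 / x ^ k)) \<longlongrightarrow> 0 * (if k = 0 then 1 else 0)) at_infinity"
    by (intro tendsto_mult lim)
  then have "((\<lambda>x. poly R x / x ^ degree R) \<longlongrightarrow> 0) at_infinity"
    by (simp add: k power_add)
  then have "lead_coeff R = 0"
    using tendsto_unique[OF trivial_limit_at_infinity] poly_divide_tendsto_aux[of R] by blast
  with \<open>R \<noteq> 0\<close> show False by simp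
qed

text \<open>Since \<open>f\<close> is bounded on discs, every point of the fibre over a large
  \<open>u\<close> is large. Each of the \<open>degree f\<close> summands of
  \<open>poly S u / u ^ M\<close> is then close to \<open>t\<close>.\<close>

lemma tendsto_sum_over_fibre:
  fixes f T :: "complex poly"
  assumes f: "degree f > 0"
    and lim: "((\<lambda>x. poly T x / poly f x ^ M) \<longlongrightarrow> t) at_infinity"
    and S: "\<And>u. poly S u = (\<Sum>x\<in>#proots (f - [:u:]). poly T x)"
  shows "((\<lambda>u. poly S u / u ^ M) \<longlongrightarrow> of_nat (degree f) * t) at_infinity"
proof (rule tendstoI)
  fix e :: real assume "e > 0"
  define e' where "e' = e / (degree f + 1)"
  have "e' > 0" using \<open>e > 0\<close> by (simp add: e'_def)
  obtain B where B: "\<And>x. norm x \<ge> B \<Longrightarrow> dist (poly T x / poly f x ^ M) t < e'"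
    using tendstoD[OF lim \<open>e' > 0\<close>] unfolding eventually_at_infinity by blast
  obtain m where m: "m > 0" "\<And>x. norm x \<le> B \<Longrightarrow> norm (poly f x) \<le> m"
    using poly_bound_exists[of B f] by blast
  show "\<forall>\<^sub>F u in at_infinity. dist (poly S u / u ^ M) (of_nat (degree f) * t) < e"
    unfolding eventually_at_infinity
  proof (intro exI allI impI)
    fix u :: complex assume u: "m + 1 \<le> norm u"
    let ?X = "proots (f - [:u:])"
    have close: "norm (poly T x / u ^ M - t) \<le> e'" if "x \<in># ?X" for x
    proof -
      have fx: "poly f x = u" using that f by simp
      then have "norm x \<ge> B" using m(2)[of x] u by (cases "norm x \<le> B") auto
      from B[OF this] show ?thesis by (simp add: fx dist_norm)
    qed
    have "norm ((\<Sum>x\<in>#X. poly T x / u ^ M) - of_nat (size X) * t) \<le> size X * e'"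
      if "set_mset X \<subseteq> set_mset ?X" for X
      using that
    proof (induction X)
      case (add x X)
      have "norm ((poly T x / u ^ M - t) + ((\<Sum>x\<in>#X. poly T x / u ^ M) - of_nat (size X) * t))
          \<le> e' + size X * e'"
        using add close by (intro norm_triangle_mono) auto
      then show ?case by (simp add: algebra_simps)
    qed simp
    from this[of ?X] have "norm ((\<Sum>x\<in>#?X. poly T x / u ^ M) - of_nat (degree f) * t) \<le> degree f * e'"
      by (simp add: size_proots_diff_const[OF f])
    also have "(\<Sum>x\<in>#?X. poly T x / u ^ M) = poly S u / u ^ M"
      unfolding S by (simp add: sum_mset_distrib_right divide_inverse)
    also have "degree f * e' < e"
      using \<open>e > 0\<close> by (simp add: e'_def field_simps)
    finally show "dist (poly S u / u ^ M) (of_nat (degree f) * t) < e"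
      by (simp add: dist_norm)
  qed
qed

lemma poly_quotient_tendsto:
  fixes p q :: "complex poly"
  assumes "degree p = degree q" "q \<noteq> 0"
  shows "((\<lambda>x. poly p x / poly q x) \<longlongrightarrow> lead_coeff p / lead_coeff q) at_infinity"
proof -
  have "((\<lambda>x. (poly p x / x ^ degree p) / (poly q x / x ^ degree q))
      \<longlongrightarrow> lead_coeff p / lead_coeff q) at_infinity"
    using assms by (intro tendsto_divide poly_divide_tendsto_aux) auto
  then show ?thesis
  proof (rule Lim_transform_eventually)
    show "\<forall>\<^sub>F x in at_infinity.
        (poly p x / x ^ degree p) / (poly q x / x ^ degree q) = poly p x / poly q x"
      using assms(1) by (intro eventually_at_infinityI[of 1]) auto
  qed
qed

text \<open>The average grows like \<open>u ^ M / lead_coeff f ^ M\<close>, and composing with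
  \<open>f\<close> restores the leading coefficient 1. So averaging maps monic polynomials to monic
  ones of the same degree.\<close>

lemma fibre_average:
  fixes f T :: "complex poly"
  assumes f: "degree f > 0" and T: "degree T = M * degree f" "lead_coeff T = 1"
  obtains S where "degree S = M" "lead_coeff (pcompose S f) = 1"
    "\<And>u. poly S u = (\<Sum>x\<in>#proots (f - [:u:]). poly T x) / of_nat (degree f)"
proof -
  obtain S0 where S0: "\<And>u. poly S0 u = (\<Sum>x\<in>#proots (f - [:u:]). poly T x)"
    using sum_over_fibre_polynomial[OF f] by metis
  define S where "S = smult (1 / of_nat (degree f)) S0"
  define t where "t = 1 / lead_coeff f ^ M"
  have f0: "f \<noteq> 0" "lead_coeff f \<noteq> 0" using f by auto
  have t0: "t \<noteq> 0" using f0 by (simp add: t_def)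
  have "((\<lambda>x. poly T x / poly (f ^ M) x) \<longlongrightarrow> lead_coeff T / lead_coeff (f ^ M)) at_infinity"
    using T f0 by (intro poly_quotient_tendsto) (auto simp: degree_power_eq)
  then have "((\<lambda>x. poly T x / poly f x ^ M) \<longlongrightarrow> t) at_infinity"
    using T by (simp add: t_def lead_coeff_power)
  from tendsto_sum_over_fibre[OF f this S0]
  have "((\<lambda>u. 1 / of_nat (degree f) * (poly S0 u / u ^ M)) \<longlongrightarrow>
      1 / of_nat (degree f) * (of_nat (degree f) * t)) at_infinity"
    by (rule tendsto_mult_left)
  then have lim: "((\<lambda>u. poly S u / u ^ M) \<longlongrightarrow> t) at_infinity"
    using f by (simp add: S_def)
  \<comment> \<open>Degree and leading coefficient of \<open>S\<close> follow once the remainder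
    \<open>R\<close> is seen to grow more slowly than \<open>u ^ M\<close>.\<close>
  define R where "R = S - monom t M"
  have "((\<lambda>u. poly S u / u ^ M - t) \<longlongrightarrow> t - t) at_infinity"
    by (intro tendsto_intros lim)
  then have "((\<lambda>u. poly S u / u ^ M - t) \<longlongrightarrow> 0) at_infinity" by simp
  then have R: "((\<lambda>u. poly R u / u ^ M) \<longlongrightarrow> 0) at_infinity"
    by (rule Lim_transform_eventually)
      (intro eventually_at_infinityI[of 1], auto simp: R_def poly_monom diff_divide_distrib)
  have S_eq: "S = monom t M + R" by (simp add: R_def)
  have deg: "degree S = M \<and> lead_coeff S = t"
  proof (cases "R = 0")
    case True
    then show ?thesis using t0 by (simp add: S_eq degree_monom_eq)
  next
    case False
    from degree_less_of_tendsto_0[OF R False] show ?thesis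
      using t0 by (simp add: S_eq degree_add_eq_left degree_monom_eq coeff_eq_0)
  qed
  show thesis
  proof
    show "degree S = M" using deg by simp
    show "lead_coeff (pcompose S f) = 1"
      using f0 by (simp add: lead_coeff_comp[OF f] conjunct1[OF deg] conjunct2[OF deg, unfolded conjunct1[OF deg]] t_def)
    show "poly S u = (\<Sum>x\<in>#proots (f - [:u:]). poly T x) / of_nat (degree f)" for u
      by (simp add: S_def S0)
  qed
qed

section \<open>Chebyshev polynomials of a compact set\<close>

definition monic_bound :: "complex set \<Rightarrow> nat \<Rightarrow> complex poly \<Rightarrow> real \<Rightarrow> bool" where
  "monic_bound E N T c \<longleftrightarrow>
     degree T = N \<and> lead_coeff T = 1 \<and> (\<forall>z\<in>E. norm (poly T z) \<le> c)"

text \<open>Attainment of the least bound is built in, so a Chebyshev polynomial of \<open>E\<close>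
  is any \<open>T\<close> with \<open>monic_bound E N T c\<close>.\<close>

definition chebyshev_bound :: "complex set \<Rightarrow> nat \<Rightarrow> real \<Rightarrow> bool" where
  "chebyshev_bound E N c \<longleftrightarrow>
     (\<exists>T. monic_bound E N T c) \<and> (\<forall>T c'. monic_bound E N T c' \<longrightarrow> c \<le> c')"

section \<open>Existence and uniqueness of Chebyshev polynomials\<close>

lemma compact_box: "compact {r :: nat \<Rightarrow> complex. \<forall>i. norm (r i) \<le> R}"
proof -
  have "compactin (product_topology (\<lambda>i::nat. euclidean) UNIV) (PiE UNIV (\<lambda>_. cball (0::complex) R))"
    by (subst compactin_PiE) auto
  moreover have "PiE UNIV (\<lambda>_::nat. cball (0::complex) R) = {r. \<forall>i. norm (r i) \<le> R}"
    by (auto simp: PiE_def)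
  ultimately show ?thesis
    by (simp add: euclidean_product_topology compactin_euclidean_iff)
qed

definition poly_of_roots :: "nat \<Rightarrow> (nat \<Rightarrow> complex) \<Rightarrow> complex poly" where
  "poly_of_roots N r = (\<Prod>i<N. [:- r i, 1:])"

lemma poly_poly_of_roots: "poly (poly_of_roots N r) z = (\<Prod>i<N. z - r i)"
  by (simp add: poly_of_roots_def poly_prod)

lemma degree_poly_of_roots: "degree (poly_of_roots N r) = N"
  unfolding poly_of_roots_def by (subst degree_prod_sum_eq) auto

lemma monic_poly_of_roots [simp]: "coeff (poly_of_roots N r) N = 1"
proof -
  have "lead_coeff (poly_of_roots N r) = 1"
    unfolding poly_of_roots_def by (subst lead_coeff_prod) auto
  then show ?thesis by (simp add: degree_poly_of_roots)
qed

text \<open>Replace each root by its nearest point in the ball. This projection is 1-Lipschitz and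
  fixes \<open>E\<close>, so no distance from a point of \<open>E\<close> to a root grows.\<close>

lemma monic_bound_roots_in_ball:
  assumes "monic_bound E N T c" "E \<subseteq> cball 0 R" "R \<ge> 0"
  obtains r where "\<And>i. norm (r i) \<le> R" "monic_bound E N (poly_of_roots N r) c"
proof -
  obtain s where s: "smult (lead_coeff T) (\<Prod>i<degree T. [:- s i, 1:]) = T"
    using complex_poly_decompose' by blast
  have T: "T = poly_of_roots N s"
    using assms(1) s by (auto simp: monic_bound_def poly_of_roots_def)
  define r where "r i = closest_point (cball 0 R) (s i)" for i
  have "norm (r i) \<le> R" for i
    using closest_point_in_set[of "cball (0::complex) R" "s i"] assms(3) by (simp add: r_def)
  moreover have "norm (poly (poly_of_roots N r) z) \<le> c" if "z \<in> E" for z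
  proof -
    have "norm (z - r i) \<le> norm (z - s i)" for i
      using closest_point_lipschitz[of "cball (0::complex) R" z "s i"] assms(2,3) that
        closest_point_self[of z "cball (0::complex) R"]
      by (auto simp: r_def dist_norm)
    then have "norm (poly (poly_of_roots N r) z) \<le> norm (poly T z)"
      unfolding T poly_poly_of_roots prod_norm[symmetric] by (intro prod_mono) auto
    also have "\<dots> \<le> c" using assms(1) that by (simp add: monic_bound_def)
    finally show ?thesis .
  qed
  ultimately show thesis
    by (intro that[of r]) (auto simp: monic_bound_def degree_poly_of_roots)
qed

text \<open>Monic polynomials are parametrized by root sequences in a ball, which form a compact set
  by Tychonoff. The conditions \<open>F c\<close> are closed and shrink with \<open>c\<close>, so a
  single sequence satisfies all attainable bounds at once.\<close>

lemma chebyshev_bound_exists: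
  assumes "compact E" "E \<noteq> {}"
  obtains c where "chebyshev_bound E N c"
proof -
  obtain R where R: "E \<subseteq> cball 0 R" "R \<ge> 0"
    using assms using compact_imp_bounded[OF assms(1)] unfolding bounded_pos by (metis dist_0_norm mem_cball subsetI less_imp_le)
  define Cs where "Cs = {c. \<exists>T. monic_bound E N T c}"
  have nonneg: "c \<ge> 0" if "c \<in> Cs" for c
    using that assms(2) norm_ge_zero order_trans unfolding Cs_def monic_bound_def by blast
  define F where "F c = {r. \<forall>z\<in>E. norm (poly (poly_of_roots N r) z) \<le> c}" for c
  define Box where "Box = {r :: nat \<Rightarrow> complex. \<forall>i. norm (r i) \<le> R}"
  have "Cs \<noteq> {}"
  proof -
    have "compact ((\<lambda>z. norm (poly (monom 1 N) z)) ` E)"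
      by (intro compact_continuous_image continuous_intros assms)
    from compact_imp_bounded[OF this]
    obtain c where "\<And>z. z \<in> E \<Longrightarrow> norm (poly (monom 1 N) z) \<le> c"
      unfolding bounded_iff by auto
    then have "monic_bound E N (monom 1 N) c"
      by (auto simp: monic_bound_def degree_monom_eq)
    then show ?thesis by (auto simp: Cs_def)
  qed
  have "Box \<inter> (\<Inter>c\<in>Cs. F c) \<noteq> {}"
  proof (rule compact_imp_fip_image)
    show "compact Box" unfolding Box_def by (rule compact_box)
    show "closed (F c)" for c
    proof -
      have "F c = (\<Inter>z\<in>E. {r. norm (\<Prod>i<N. z - r i) \<le> c})"
        by (auto simp: F_def poly_poly_of_roots)
      moreover have "closed {r. norm (\<Prod>i<N. z - r i) \<le> c}" for z :: complex
        by (intro closed_Collect_le continuous_intros continuous_on_product_coordinates)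
      ultimately show ?thesis by auto
    qed
    fix I assume I: "finite I" "I \<subseteq> Cs"
    show "Box \<inter> (\<Inter>c\<in>I. F c) \<noteq> {}"
    proof -
      obtain c where c: "c \<in> Cs" "\<And>d. d \<in> I \<Longrightarrow> c \<le> d"
      proof (cases "I = {}")
        case False
        then show ?thesis using that[of "Min I"] I by (meson Min_in Min_le subsetD)
      qed (use that \<open>Cs \<noteq> {}\<close> in auto)
      then obtain T where "monic_bound E N T c" by (auto simp: Cs_def)
      from monic_bound_roots_in_ball[OF this R] obtain r where
        "\<And>i. norm (r i) \<le> R" "monic_bound E N (poly_of_roots N r) c" by metis
      then have "r \<in> Box" "\<forall>d\<in>I. r \<in> F d"
        using c(2) by (auto simp: Box_def F_def monic_bound_def intro: order_trans)
      then show ?thesis by blast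
    qed
  qed
  then obtain r where r: "r \<in> (\<Inter>c\<in>Cs. F c)" by blast
  have bdd: "bdd_below Cs" using nonneg by (intro bdd_belowI[of _ 0]) auto
  have "norm (poly (poly_of_roots N r) z) \<le> Inf Cs" if "z \<in> E" for z
    using r that \<open>Cs \<noteq> {}\<close> by (intro cInf_greatest) (auto simp: F_def)
  then have "monic_bound E N (poly_of_roots N r) (Inf Cs)"
    by (simp add: monic_bound_def degree_poly_of_roots)
  moreover have "Inf Cs \<le> c'" if "monic_bound E N T c'" for T c'
    using that bdd by (intro cInf_lower) (auto simp: Cs_def)
  ultimately show thesis using that unfolding chebyshev_bound_def by blast
qed

lemma monic_bound_convex:
  assumes "monic_bound E N T c" "monic_bound E N W w" "0 \<le> e" "e \<le> 1"
  shows "degree (smult (of_real (1 - e)) T + smult (of_real e) W) = N"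
    "lead_coeff (smult (of_real (1 - e)) T + smult (of_real e) W) = 1"
proof -
  let ?V = "smult (of_real (1 - e)) T + smult (of_real e) W"
  have "coeff ?V N = 1" using assms by (auto simp: monic_bound_def simp flip: of_real_add)
  moreover have "degree ?V \<le> N"
    using assms by (intro degree_add_le) (auto simp: monic_bound_def intro: order_trans[OF degree_smult_le])
  ultimately show "degree ?V = N" by (metis le_antisym le_degree zero_neq_one)
  with \<open>coeff ?V N = 1\<close> show "lead_coeff ?V = 1" by simp
qed

text \<open>If the extremal points were few, moving \<open>T\<close> slightly towards a monic \<open>W\<close> vanishing at
  all of them would decrease the maximum.\<close>

lemma many_extremal_points:
  assumes E: "compact E" and c: "chebyshev_bound E N c" "c > 0" and T: "monic_bound E N T c"
    and fin: "finite {z\<in>E. norm (poly T z) = c}"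
  shows "card {z\<in>E. norm (poly T z) = c} > N"
proof (rule ccontr)
  define M where "M = {z\<in>E. norm (poly T z) = c}"
  assume "\<not> card {z\<in>E. norm (poly T z) = c} > N"
  then have card: "card M \<le> N" by (simp add: M_def)
  have finM: "finite M" using fin by (simp add: M_def)
  \<comment> \<open>Monic of degree exactly \<open>N\<close> and zero at all extremal points; the
    monomial pads the degree.\<close>
  define W where "W = (\<Prod>z\<in>M. [:-z, 1:]) * monom 1 (N - card M)"
  have Wz: "poly W z = 0" if "z \<in> M" for z
    using that finM by (auto simp: W_def poly_prod)
  have "(\<Prod>z\<in>M. [:-z, 1:]) \<noteq> 0" using finM by auto
  then have degW: "degree W = N"
    using card by (simp add: W_def degree_mult_eq degree_monom_eq degree_prod_sum_eq)
  have leadW: "lead_coeff W = 1"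
    by (simp add: W_def lead_coeff_mult lead_coeff_prod degree_monom_eq)
  have "bounded (poly W ` E)"
    by (intro compact_imp_bounded compact_continuous_image continuous_intros E)
  then obtain w where w: "w > 0" "\<And>z. z \<in> E \<Longrightarrow> norm (poly W z) \<le> w"
    unfolding bounded_pos by auto
  have W: "monic_bound E N W w" using degW leadW w by (simp add: monic_bound_def)
  \<comment> \<open>Off \<open>U\<close> the competitor \<open>W\<close> is below
    \<open>c / 2\<close>; the compact set \<open>U\<close> contains no extremal point, so there
    \<open>T\<close> stays below some \<open>\<rho> < c\<close>.\<close>
  define U where "U = {z\<in>E. norm (poly W z) \<ge> c / 2}"
  have "compact (E \<inter> {z. norm (poly W z) \<ge> c / 2})"
    by (intro compact_Int_closed E closed_Collect_le continuous_intros)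
  then have U: "compact U" by (simp add: U_def Int_def)
  have Tle: "norm (poly T z) \<le> c" if "z \<in> E" for z using T that by (simp add: monic_bound_def)
  obtain \<rho> where \<rho>: "\<rho> < c" "\<rho> \<ge> 0" "\<And>z. z \<in> U \<Longrightarrow> norm (poly T z) \<le> \<rho>"
  proof (cases "U = {}")
    case True
    then show ?thesis using that[of 0] c by auto
  next
    case False
    have "continuous_on U (\<lambda>z. norm (poly T z))" by (intro continuous_intros)
    from continuous_attains_sup[OF U False this] obtain z where
      z: "z \<in> U" "\<forall>y\<in>U. norm (poly T y) \<le> norm (poly T z)" by blast
    have "z \<notin> M" using Wz[of z] z(1) c by (auto simp: U_def)
    then have "norm (poly T z) < c" using z(1) Tle[of z] by (auto simp: U_def M_def)
    then show ?thesis using that[of "norm (poly T z)"] z by auto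
  qed
  \<comment> \<open>On \<open>U\<close> the mixture gains at most \<open>e * w\<close>, which is
    kept within half of the gap \<open>c - \<rho>\<close>; off \<open>U\<close> any such positive
    \<open>e\<close> lowers the bound.\<close>
  define e where "e = min (1/2) ((c - \<rho>) / (2 * w))"
  have e: "0 < e" "e \<le> 1/2" "e * w \<le> (c - \<rho>) / 2"
  proof -
    show "0 < e" "e \<le> 1/2" using \<rho> w by (auto simp: e_def)
    have "e * w \<le> (c - \<rho>) / (2 * w) * w"
      using w by (intro mult_right_mono) (auto simp: e_def)
    then show "e * w \<le> (c - \<rho>) / 2" using w by simp
  qed
  define V where "V = smult (of_real (1 - e)) T + smult (of_real e) W"
  define c' where "c' = max ((1 - e) * c + e * (c / 2)) (\<rho> + (c - \<rho>) / 2)"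
  have "norm (poly V z) \<le> c'" if "z \<in> E" for z
  proof -
    have "norm (poly V z) \<le> norm (of_real (1 - e) * poly T z) + norm (of_real e * poly W z)"
      unfolding V_def by (simp add: norm_triangle_ineq)
    also have "\<dots> = (1 - e) * norm (poly T z) + e * norm (poly W z)"
      using e by (simp only: norm_mult norm_of_real)
    also have "\<dots> \<le> c'"
    proof (cases "z \<in> U")
      case True
      have "(1 - e) * norm (poly T z) \<le> 1 * \<rho>" using e \<rho> True by (intro mult_mono) auto
      moreover have "e * norm (poly W z) \<le> e * w" using e w that by (intro mult_left_mono) auto
      ultimately show ?thesis using e unfolding c'_def by linarith
    next
      case False
      have "(1 - e) * norm (poly T z) \<le> (1 - e) * c" using e Tle[OF that] by (intro mult_left_mono) auto
      moreover have "e * norm (poly W z) \<le> e * (c / 2)"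
        using e False that by (intro mult_left_mono) (auto simp: U_def)
      ultimately show ?thesis unfolding c'_def by linarith
    qed
    finally show ?thesis .
  qed
  then have "monic_bound E N V c'"
    using monic_bound_convex[OF T W, of e] e unfolding V_def by (auto simp: monic_bound_def)
  then have "c \<le> c'" using c by (simp add: chebyshev_bound_def)
  moreover have "(1 - e) * c + e * (c / 2) < c" using e c by (simp add: algebra_simps)
  moreover have "\<rho> + (c - \<rho>) / 2 < c" using \<rho>(1) by (simp add: field_simps)
  ultimately show False unfolding c'_def by linarith
qed

text \<open>Strict convexity of the modulus, by the parallelogram law.\<close>

lemma norm_midpoint_eq:
  fixes a b :: complex
  assumes "norm a \<le> c" "norm b \<le> c" "norm ((a + b) / 2) = c"
  shows "a = b"
proof -
  have "norm (a + b) = 2 * c" using assms(3) by (simp add: norm_divide)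
  then have "(norm (a + b))\<^sup>2 = 4 * c\<^sup>2" by (simp add: power_mult_distrib)
  moreover have "(norm (a - b))\<^sup>2 + (norm (a + b))\<^sup>2 = 2 * (norm a)\<^sup>2 + 2 * (norm b)\<^sup>2"
    unfolding cmod_power2 by (simp add: power2_eq_square algebra_simps)
  ultimately have "(norm (a - b))\<^sup>2 = 2 * (norm a)\<^sup>2 + 2 * (norm b)\<^sup>2 - 4 * c\<^sup>2"
    by linarith
  moreover have "(norm a)\<^sup>2 \<le> c\<^sup>2" "(norm b)\<^sup>2 \<le> c\<^sup>2" using assms by (simp_all add: power_mono)
  ultimately have "(norm (a - b))\<^sup>2 \<le> 0" by simp
  then show ?thesis by simp
qed

text \<open>The midpoint of two minimizers is a minimizer. By strict convexity both agree at its
  extremal points, of which there are more than \<open>N\<close>, while their difference has degree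
  at most \<open>N\<close>.\<close>

lemma chebyshev_unique:
  assumes E: "compact E" "infinite E" and c: "chebyshev_bound E N c"
    and T1: "monic_bound E N T1 c" and T2: "monic_bound E N T2 c"
  shows "T1 = T2"
proof (rule ccontr)
  assume "T1 \<noteq> T2"
  define T where "T = smult (of_real (1 - 1/2)) T1 + smult (of_real (1/2)) T2"
  have Tz: "poly T z = (poly T1 z + poly T2 z) / 2" for z by (simp add: T_def field_simps)
  have "norm (poly T z) \<le> c" if "z \<in> E" for z
  proof -
    have "norm (poly T z) \<le> (norm (poly T1 z) + norm (poly T2 z)) / 2"
      by (simp add: Tz norm_divide norm_triangle_ineq)
    also have "\<dots> \<le> (c + c) / 2" using T1 T2 that by (intro divide_right_mono add_mono) (auto simp: monic_bound_def)
    finally show ?thesis by simp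
  qed
  then have T: "monic_bound E N T c"
    using monic_bound_convex[OF T1 T2, of "1/2"] unfolding T_def by (auto simp: monic_bound_def)
  \<comment> \<open>Otherwise the nonzero polynomial \<open>T\<close> would vanish on the infinite
    set \<open>E\<close>.\<close>
  have "c > 0"
  proof (rule ccontr)
    assume "\<not> c > 0"
    then have "norm (poly T z) \<le> 0" if "z \<in> E" for z
      using T that by (fastforce simp: monic_bound_def intro: order_trans)
    then have "E \<subseteq> {z. poly T z = 0}" by auto
    moreover have "T \<noteq> 0" using T by (auto simp: monic_bound_def)
    ultimately show False using E(2) poly_roots_finite finite_subset by blast
  qed
  define M where "M = {z\<in>E. norm (poly T z) = c}"
  have D: "M \<subseteq> {z. poly (T1 - T2) z = 0}"
    using T1 T2 norm_midpoint_eq by (auto simp: M_def Tz monic_bound_def)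
  have nz: "T1 - T2 \<noteq> 0" using \<open>T1 \<noteq> T2\<close> by simp
  have finM: "finite M" using D finite_subset poly_roots_finite[OF nz] by blast
  then have "card M > N"
    using many_extremal_points[OF E(1) c \<open>c > 0\<close> T] by (simp add: M_def)
  moreover have "card M \<le> card {z. poly (T1 - T2) z = 0}"
    using D poly_roots_finite[OF nz] by (intro card_mono)
  moreover have "card {z. poly (T1 - T2) z = 0} \<le> degree (T1 - T2)"
    by (rule card_poly_roots_bound[OF nz])
  moreover have "degree (T1 - T2) \<le> N"
    using T1 T2 degree_diff_le_max[of T1 T2] by (simp add: monic_bound_def)
  ultimately show False by linarith
qed

section \<open>Saturated sets\<close>

definition saturated :: "complex set \<Rightarrow> complex poly \<Rightarrow> bool" where
  "saturated K p \<longleftrightarrow> (\<forall>x y. poly p x = poly p y \<longrightarrow> x \<in> K \<longrightarrow> y \<in> K)"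

lemma saturated_vimage: "saturated (poly p -` K) p"
  by (auto simp: saturated_def)

lemma saturated_pcompose:
  assumes "saturated L A" "K = poly p -` L"
  shows "saturated K (pcompose A p)"
  unfolding saturated_def poly_pcompose
proof (intro allI impI)
  fix x y
  assume "poly A (poly p x) = poly A (poly p y)" "x \<in> K"
  moreover have "poly p x \<in> L" using assms(2) \<open>x \<in> K\<close> by simp
  ultimately have "poly p y \<in> L" using assms(1) unfolding saturated_def by blast
  then show "y \<in> K" using assms(2) by simp
qed

text \<open>Saturation keeps the fibres through \<open>E\<close> inside \<open>E\<close>, so the
  average of \<open>T\<close> over them is still bounded by \<open>c\<close>. It is again monic of
  the same degree, and uniqueness identifies it with \<open>T\<close>.\<close>

lemma chebyshev_factors:
  assumes E: "compact E" "infinite E" and c: "chebyshev_bound E (M * degree f) c"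
    and T: "monic_bound E (M * degree f) T c"
    and f: "degree f > 0" "saturated E f"
  obtains A where "degree A = M" "T = pcompose A f"
proof -
  have degT: "degree T = M * degree f" "lead_coeff T = 1" using T by (auto simp: monic_bound_def)
  obtain S where S: "degree S = M" "lead_coeff (pcompose S f) = 1"
    "\<And>u. poly S u = (\<Sum>x\<in>#proots (f - [:u:]). poly T x) / of_nat (degree f)"
    using fibre_average[OF f(1) degT] by metis
  have "norm (poly (pcompose S f) x) \<le> c" if "x \<in> E" for x
  proof -
    have le: "norm (\<Sum>y\<in>#X. poly T y) \<le> size X * c" if "set_mset X \<subseteq> E" for X
      using that
    proof (induction X)
      case (add y X)
      then have "norm (poly T y + (\<Sum>y\<in>#X. poly T y)) \<le> c + size X * c"
        using T by (intro norm_triangle_mono) (auto simp: monic_bound_def)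
      then show ?case by (simp add: algebra_simps)
    qed simp
    have "set_mset (proots (f - [:poly f x:])) \<subseteq> E"
    proof
      fix y assume "y \<in># proots (f - [:poly f x:])"
      then have "poly f x = poly f y" using f(1) by simp
      then show "y \<in> E" using f(2) that unfolding saturated_def by blast
    qed
    from le[OF this] show ?thesis
      using f(1) by (simp add: poly_pcompose S(3) norm_divide size_proots_diff_const field_simps)
  qed
  then have "monic_bound E (M * degree f) (pcompose S f) c"
    using S by (auto simp: monic_bound_def degree_pcompose)
  then have "T = pcompose S f" by (rule chebyshev_unique[OF E c T])
  with S(1) that show thesis by blast
qed

text \<open>The Chebyshev polynomial of \<open>E\<close> whose degree is the least common multiple
  factors through both \<open>f\<close> and \<open>g\<close>.\<close>

lemma common_composite:
  assumes E: "compact E" "infinite E"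
    and f: "degree f > 0" "saturated E f" and g: "degree g > 0" "saturated E g"
  obtains A B where "pcompose A f = pcompose B g"
    "degree A * degree f = lcm (degree f) (degree g)"
    "degree B * degree g = lcm (degree f) (degree g)"
proof -
  define N where "N = lcm (degree f) (degree g)"
  obtain k l where kl: "N = k * degree f" "N = l * degree g"
    unfolding N_def by (metis dvd_div_mult_self dvd_lcm1 dvd_lcm2)
  have "E \<noteq> {}" using E by auto
  then obtain c where c: "chebyshev_bound E N c" using chebyshev_bound_exists[OF E(1)] by blast
  then obtain T where T: "monic_bound E N T c" by (auto simp: chebyshev_bound_def)
  obtain A where A: "degree A = k" "T = pcompose A f"
    using chebyshev_factors[OF E c[unfolded kl(1)] T[unfolded kl(1)] f] by blast
  obtain B where B: "degree B = l" "T = pcompose B g"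
    using chebyshev_factors[OF E c[unfolded kl(2)] T[unfolded kl(2)] g] by blast
  show thesis using that[of A B] A B kl by (simp add: N_def)
qed

section \<open>The curve \<open>A(u) = B(y)\<close>\<close>

text \<open>Convention for \<open>complex poly poly\<close>: the outer variable is \<open>y\<close>,
  and the coefficients are polynomials in \<open>u\<close>.\<close>

lemma poly_map_poly_poly:
  fixes P :: "complex poly poly"
  shows "poly (map_poly (\<lambda>c. poly c u) P) y = poly (poly P [:y:]) u"
  by (induction P) (auto simp: map_poly_pCons)

lemma poly_poly_eq_sum:
  fixes P :: "complex poly poly"
  shows "poly (poly P [:y:]) u = (\<Sum>j\<le>degree P. poly (coeff P j) u * y ^ j)"
proof -
  have "poly ([:y:] ^ j) u = y ^ j" for j by (simp add: poly_power)
  then show ?thesis by (simp add: poly_altdef[of P] poly_sum)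
qed

text \<open>The nonzero term of highest degree could not be cancelled by any other.\<close>

lemma sum_distinct_degrees_eq_0:
  fixes t :: "'i \<Rightarrow> 'a::comm_ring_1 poly"
  assumes "finite I" "(\<Sum>i\<in>I. t i) = 0"
    and inj: "\<And>i j. i \<in> I \<Longrightarrow> j \<in> I \<Longrightarrow> t i \<noteq> 0 \<Longrightarrow> t j \<noteq> 0 \<Longrightarrow> degree (t i) = degree (t j) \<Longrightarrow> i = j"
    and "i \<in> I"
  shows "t i = 0"
proof (rule ccontr)
  define J where "J = {i\<in>I. t i \<noteq> 0}"
  assume "t i \<noteq> 0"
  then have J: "finite J" "J \<noteq> {}" using assms by (auto simp: J_def)
  have "Max ((\<lambda>j. degree (t j)) ` J) \<in> (\<lambda>j. degree (t j)) ` J" using J by (intro Max_in) auto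
  then obtain m where m: "m \<in> J" "Max ((\<lambda>j. degree (t j)) ` J) = degree (t m)" by auto
  have m_max: "degree (t j) \<le> degree (t m)" if "j \<in> J" for j
    unfolding m(2)[symmetric] using that J by (intro Max_ge) auto
  have "coeff (t j) (degree (t m)) = 0" if "j \<in> I - {m}" for j
  proof (cases "t j = 0")
    case False
    then have "degree (t j) \<noteq> degree (t m)" "degree (t j) \<le> degree (t m)"
      using inj[of j m] m(1) m_max[of j] that by (auto simp: J_def)
    then show ?thesis by (intro coeff_eq_0) auto
  qed simp
  then have "coeff (\<Sum>i\<in>I. t i) (degree (t m)) = coeff (t m) (degree (t m))"
    using m(1) assms(1) by (simp add: coeff_sum J_def sum.remove[of I m])
  then show False using m(1) assms(2) by (simp add: J_def)
qed

lemma order_prod_mset_linear: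
  fixes h :: "complex \<Rightarrow> complex"
  shows "order y (\<Prod>x\<in>#X. [:- h x, 1:]) = size {#x \<in># X. h x = y#}"
proof (induction X)
  case (add x X)
  have nz: "(\<Prod>x\<in>#X. [:- h x, 1:]) \<noteq> 0" using lead_coeff_prod_mset_linear[of h X] by fastforce
  have "order y [:- h x, 1:] = (if h x = y then 1 else 0)"
    using order_power_n_n[of y 1] by (auto intro: order_0I)
  then show ?case using add nz by (simp add: order_mult del: mult_pCons_left)
qed simp

text \<open>The degree equations say that the common composite has the least possible degree. This
  makes every point of the curve \<open>A(u) = B(y)\<close> have the form
  \<open>(f x, g x)\<close>.\<close>

locale composite =
  fixes f g A B :: "complex poly"
  assumes comp: "pcompose A f = pcompose B g"
    and f_nonconst: "degree f > 0" and g_nonconst: "degree g > 0"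
    and degree_A: "degree A * degree f = lcm (degree f) (degree g)"
    and degree_B: "degree B * degree g = lcm (degree f) (degree g)"
begin

lemma comp_eval: "poly A (poly f x) = poly B (poly g x)"
  using comp by (metis poly_pcompose)

lemma A_nonconst: "degree A > 0" and B_nonconst: "degree B > 0"
  using degree_A degree_B f_nonconst g_nonconst by (metis gr0I lcm_pos_nat mult_0 less_not_refl)+

text \<open>\<open>B(y) - A(u)\<close> divides the norm of \<open>y - g\<close> along \<open>f\<close>: a remainder \<open>R(u, y)\<close> with
  \<open>deg\<^sub>y R < deg B\<close> and \<open>R(f, g) = 0\<close> is zero, because its monomials \<open>f\<^sup>i g\<^sup>j\<close> have pairwise different
  degrees.\<close>

lemma fibre_prod_factor:
  obtains c :: complex and Q :: "complex poly poly"
  where "c \<noteq> 0"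
    "\<And>u. smult c (fibre_prod f g u) = (B - [:poly A u:]) * map_poly (\<lambda>q. poly q u) Q"
proof -
  obtain C where C: "\<And>u. map_poly (\<lambda>c. poly c u) C = fibre_prod f g u"
    using fibre_prod_polynomial[OF f_nonconst] by metis
  \<comment> \<open>\<open>B(y) - A(u)\<close> as a polynomial in \<open>y\<close> over the
    polynomials in \<open>u\<close>.\<close>
  define F where "F = map_poly (\<lambda>b. [:b:]) B - [:A:]"
  have Feval: "poly (poly F [:y:]) u = poly B y - poly A u" for y u
  proof -
    have "poly (map_poly (\<lambda>b. [:b:]) B) [:y:] = [:poly B y:]"
      by (induction B) (auto simp: map_poly_pCons)
    then show ?thesis by (simp add: F_def)
  qed
  have degF: "degree F = degree B"
  proof -
    have "degree (map_poly (\<lambda>b. [:b:]) B) = degree B" by (rule degree_map_poly) auto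
    then show ?thesis
      using B_nonconst degree_add_eq_left[of "-[:A:]" "map_poly (\<lambda>b. [:b:]) B"]
      by (simp add: F_def diff_conv_add_uminus del: add_uminus_conv_diff)
  qed
  have F0: "F \<noteq> 0" using degF B_nonconst by auto
  have leadF: "coeff F (degree B) = [:lead_coeff B:]"
    using B_nonconst by (simp add: F_def coeff_map_poly coeff_pCons split: nat.split)
  obtain Q R where QR: "pseudo_divmod C F = (Q, R)" by fastforce
  \<comment> \<open>The leading coefficient of \<open>F\<close> in \<open>y\<close> is a constant,
    so the pseudo-division multiplies \<open>C\<close> only by the constant
    \<open>c\<close>.\<close>
  define c where "c = lead_coeff B ^ (Suc (degree C) - degree F)"
  have "[:lead_coeff B:] ^ k = [:lead_coeff B ^ k:]" for k by (induction k) auto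
  then have div: "smult [:c:] C = F * Q + R" and degR: "R = 0 \<or> degree R < degree B"
    using pseudo_divmod[OF F0 QR] by (auto simp: leadF c_def degF)
  \<comment> \<open>Both \<open>C\<close> and \<open>F\<close> vanish at \<open>u = f x\<close>,
    \<open>y = g x\<close>, hence so does the remainder.\<close>
  have Rfg: "poly (poly R [:poly g x:]) (poly f x) = 0" for x
  proof -
    have "x \<in># proots (f - [:poly f x:])" using f_nonconst by simp
    then have "0 \<in># {#poly g x - poly g y. y \<in># proots (f - [:poly f x:])#}" by force
    then have "(\<Prod>y\<in>#proots (f - [:poly f x:]). poly g x - poly g y) = 0"
      using prod_mset_zero_iff by blast
    then have "poly (fibre_prod f g (poly f x)) (poly g x) = 0"
      by (simp add: fibre_prod_def poly_prod_mset)
    then have "poly (poly C [:poly g x:]) (poly f x) = 0"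
      by (simp flip: C add: poly_map_poly_poly)
    then show ?thesis
      using arg_cong[OF div, of "\<lambda>P. poly (poly P [:poly g x:]) (poly f x)"]
      by (simp add: Feval comp_eval)
  qed
  have "R = 0"
  proof (rule ccontr)
    assume "R \<noteq> 0"
    then have degR: "degree R < degree B" using degR by simp
    define t where "t j = pcompose (coeff R j) f * g ^ j" for j
    have "poly (\<Sum>j\<le>degree R. t j) x = poly 0 x" for x
      using Rfg[of x] by (simp add: poly_poly_eq_sum t_def poly_sum poly_pcompose poly_power)
    then have sum: "(\<Sum>j\<le>degree R. t j) = 0" by (simp add: fun_eq_iff flip: poly_eq_poly_eq_iff)
    have g0: "g \<noteq> 0" using g_nonconst by auto
    have degt: "degree (t j) = degree (coeff R j) * degree f + j * degree g" if "t j \<noteq> 0" for j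
      using that g0 by (subst t_def, subst degree_mult_eq) (auto simp: t_def degree_power_eq degree_pcompose)
    have less: "degree (t i) \<noteq> degree (t j)"
      if "i \<le> degree R" "j \<le> degree R" "t i \<noteq> 0" "t j \<noteq> 0" "i < j" for i j
    proof
      define a b where "a = degree (coeff R i)" and "b = degree (coeff R j)"
      assume "degree (t i) = degree (t j)"
      then have eq: "a * degree f + i * degree g = b * degree f + j * degree g"
        using that by (simp add: degt a_def b_def)
      \<comment> \<open>Equal degrees would make \<open>(j - i) * degree g\<close> a positive common
        multiple of both degrees, although \<open>j - i < degree B\<close> puts it below the least
        one.\<close>
      have "(j - i) * degree g = (a - b) * degree f"
        using eq that(5) by (simp add: diff_mult_distrib)
      then have "lcm (degree f) (degree g) dvd (j - i) * degree g"
        by (metis dvd_triv_right lcm_least)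
      then have "lcm (degree f) (degree g) \<le> (j - i) * degree g"
        using that(5) g_nonconst by (intro dvd_imp_le) auto
      also have "\<dots> < degree B * degree g"
        using that degR g_nonconst by (intro mult_strict_right_mono) auto
      finally show False using degree_B by simp
    qed
    have "t (degree R) = 0"
    proof (rule sum_distinct_degrees_eq_0[OF _ sum])
      show "i = j" if "i \<in> {..degree R}" "j \<in> {..degree R}" "t i \<noteq> 0" "t j \<noteq> 0"
        "degree (t i) = degree (t j)" for i j
        using less[of i j] less[of j i] that by (metis atMost_iff linorder_neqE_nat)
    qed auto
    moreover have "pcompose (lead_coeff R) f \<noteq> 0"
      using \<open>R \<noteq> 0\<close> f_nonconst by (simp add: pcompose_eq_0_iff)
    ultimately show False using g0 by (simp add: t_def)
  qed
  have "poly (smult c (fibre_prod f g u)) y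
      = poly ((B - [:poly A u:]) * map_poly (\<lambda>q. poly q u) Q) y" for u y
    using arg_cong[OF div, of "\<lambda>P. poly (poly P [:y:]) u"] \<open>R = 0\<close>
    by (simp add: Feval poly_map_poly_poly flip: C)
  then have "smult c (fibre_prod f g u) = (B - [:poly A u:]) * map_poly (\<lambda>q. poly q u) Q" for u
    by (simp add: fun_eq_iff flip: poly_eq_poly_eq_iff)
  moreover have "c \<noteq> 0" using B_nonconst by (auto simp: c_def)
  ultimately show thesis using that by blast
qed

text \<open>A root \<open>y\<close> of \<open>B - A(u)\<close> is also a root of
  \<open>fibre_prod f g u\<close>, whose roots are the values of \<open>g\<close> on the fibre of
  \<open>f\<close> over \<open>u\<close>.\<close>

lemma common_point:
  assumes "poly A u = poly B y"
  obtains x where "poly f x = u" "poly g x = y"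
proof -
  obtain c Q where cQ: "c \<noteq> 0"
    "\<And>u. smult c (fibre_prod f g u) = (B - [:poly A u:]) * map_poly (\<lambda>q. poly q u) Q"
    using fibre_prod_factor by metis
  have "poly (fibre_prod f g u) y = 0"
    using arg_cong[OF cQ(2)[of u], of "\<lambda>p. poly p y"] assms cQ(1) by simp
  then have "(\<Prod>x\<in>#proots (f - [:u:]). y - poly g x) = 0"
    by (simp add: fibre_prod_def poly_prod_mset)
  then have "0 \<in># {#y - poly g x. x \<in># proots (f - [:u:])#}"
    using prod_mset_zero_iff by blast
  then obtain x where "x \<in># proots (f - [:u:])" "y = poly g x" by auto
  then show thesis using that f_nonconst by simp
qed

end

locale coprime_composite = composite +
  assumes coprime_degrees: "coprime (degree f) (degree g)"
begin

lemma degree_B_eq: "degree B = degree f" and degree_A_eq: "degree A = degree g"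
proof -
  have "lcm (degree f) (degree g) = degree f * degree g"
    using lcm_coprime[of "degree f" "degree g"] coprime_degrees by (simp add: coprime_iff_gcd_eq_1)
  then show "degree B = degree f" "degree A = degree g"
    using degree_A degree_B f_nonconst g_nonconst by (simp_all add: mult.commute)
qed

text \<open>For coprime degrees \<open>B - A(u)\<close> and \<open>fibre_prod f g u\<close> have
  equal degree in \<open>y\<close>, so the cofactor is a nonzero constant and their orders at
  \<open>y\<close> agree.\<close>

lemma sum_pmult_common_points:
  assumes "poly A u = poly B y"
  shows "(\<Sum>x | poly f x = u \<and> poly g x = y. pmult f x) = pmult B y"
proof -
  obtain c Q where cQ: "c \<noteq> 0"
    "\<And>u. smult c (fibre_prod f g u) = (B - [:poly A u:]) * map_poly (\<lambda>q. poly q u) Q"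
    using fibre_prod_factor by metis
  define q where "q = map_poly (\<lambda>q. poly q u) Q"
  have eq: "smult c (fibre_prod f g u) = (B - [:poly A u:]) * q" using cQ(2) q_def by simp
  have fib0: "fibre_prod f g u \<noteq> 0"
    using lead_coeff_fibre_prod[of f g u] by fastforce
  have nz: "(B - [:poly A u:]) * q \<noteq> 0" unfolding eq[symmetric] using cQ(1) fib0 by simp
  have "degree B = degree (smult c (fibre_prod f g u))"
    using cQ(1) f_nonconst by (simp add: degree_fibre_prod degree_B_eq)
  also have "\<dots> = degree B + degree q"
    unfolding eq using nz B_nonconst by (subst degree_mult_eq) auto
  finally have "degree q = 0" by simp
  then obtain k where k: "q = [:k:]" by (rule degree_eq_zeroE)
  have "k \<noteq> 0" using nz k by auto
  have "order y (smult c (fibre_prod f g u)) = order y (smult k (B - [:poly A u:]))"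
    unfolding eq k by simp
  then have "order y (fibre_prod f g u) = pmult B y"
    using cQ(1) \<open>k \<noteq> 0\<close> assms by (simp add: order_smult pmult_def)
  moreover have "order y (fibre_prod f g u) = (\<Sum>x | poly f x = u \<and> poly g x = y. pmult f x)"
  proof -
    let ?X = "proots (f - [:u:])"
    have "order y (fibre_prod f g u) = size {#x \<in># ?X. poly g x = y#}"
      unfolding fibre_prod_def by (rule order_prod_mset_linear)
    also have "\<dots> = (\<Sum>x | poly f x = u \<and> poly g x = y. pmult f x)"
      unfolding size_multiset_overloaded_eq using f_nonconst
      by (intro sum.cong) (auto simp: pmult_def)
    finally show ?thesis .
  qed
  ultimately show ?thesis by simp
qed

lemma pmult_chain: "pmult A (poly f x) * pmult f x = pmult B (poly g x) * pmult g x"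
  using comp pmult_pcompose[OF f_nonconst A_nonconst] pmult_pcompose[OF g_nonconst B_nonconst]
  by metis

end

section \<open>Ramification of coprime composites\<close>

definition ramif :: "complex poly \<Rightarrow> complex \<Rightarrow> nat" where
  "ramif p u = (\<Sum>x | poly p x = u. pmult p x - 1)"

definition critical_values :: "complex poly \<Rightarrow> complex set" where
  "critical_values p = {u. \<exists>x. poly p x = u \<and> pmult p x \<ge> 2}"

lemma finite_critical_values:
  assumes "degree p > 0"
  shows "finite (critical_values p)"
proof -
  have "critical_values p \<subseteq> poly p ` {x. pmult p x > 1}" by (auto simp: critical_values_def)
  then show ?thesis using finite_critical[OF assms] finite_surj by blast
qed

lemma card_fibre:
  assumes "degree p > 0"
  shows "card {x. poly p x = u} + ramif p u = degree p"
proof -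
  have "card {x. poly p x = u} + ramif p u = (\<Sum>x | poly p x = u. 1 + (pmult p x - 1))"
    by (subst sum.distrib) (simp add: ramif_def)
  also have "\<dots> = (\<Sum>x | poly p x = u. pmult p x)"
  proof (rule sum.cong)
    show "1 + (pmult p x - 1) = pmult p x" for x using pmult_pos[OF assms, of x] by simp
  qed simp
  finally show ?thesis using sum_pmult_fibre[OF assms] by simp
qed

lemma sum_ramif_eq:
  assumes "degree p > 0" "finite U"
  shows "(\<Sum>u\<in>U. ramif p u) = (\<Sum>x\<in>(\<Union>u\<in>U. {x. poly p x = u}). pmult p x - 1)"
  unfolding ramif_def using assms
  by (intro sum.UNION_disjoint[symmetric]) (auto simp: finite_fibre)

lemma sum_ramif_le:
  assumes "degree p > 0" "finite U"
  shows "(\<Sum>u\<in>U. ramif p u) \<le> degree p - 1"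
  unfolding sum_ramif_eq[OF assms] using assms
  by (intro sum_ramification_le) (auto simp: finite_fibre)

lemma sum_ramif:
  assumes "degree p > 0" "finite U" "critical_values p \<subseteq> U"
  shows "(\<Sum>u\<in>U. ramif p u) = degree p - 1"
proof -
  have "poly p x \<in> U" if "pmult p x > 1" for x
    using assms(3) that unfolding critical_values_def by (auto simp: subset_iff Suc_le_eq numeral_2_eq_2)
  then show ?thesis
    unfolding sum_ramif_eq[OF assms(1,2)] using assms
    by (intro sum_ramification) (auto simp: finite_fibre)
qed

lemma ramif_ge:
  assumes "degree p > 0" "poly p x = u"
  shows "pmult p x - 1 \<le> ramif p u"
  unfolding ramif_def using assms by (intro member_le_sum) (auto simp: finite_fibre)

lemma card_fibres_ge:
  fixes p :: "complex poly"
  assumes "degree p > 0" "finite V"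
  shows "card V * degree p \<le> (\<Sum>u\<in>V. card {x. poly p x = u}) + (degree p - 1)"
proof -
  have "card V * degree p = (\<Sum>u\<in>V. card {x. poly p x = u} + ramif p u)"
    using card_fibre[OF assms(1)] by simp
  also have "\<dots> = (\<Sum>u\<in>V. card {x. poly p x = u}) + (\<Sum>u\<in>V. ramif p u)"
    by (rule sum.distrib)
  finally show ?thesis using sum_ramif_le[OF assms] by linarith
qed

text \<open>A point of index at least \<open>k\<close> uses up at least \<open>k\<close> units of
  the degree; any other point uses at least one, and the deficit \<open>k - 1\<close> is
  added.\<close>

lemma card_fibre_le:
  fixes p :: "complex poly"
  assumes "degree p > 0"
  shows "k * card {x. poly p x = u}
    \<le> degree p + (k - 1) * card {x. poly p x = u \<and> pmult p x < k}"
proof -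
  let ?F = "{x. poly p x = u}"
  have "k * card ?F = (\<Sum>x\<in>?F. k)" by simp
  also have "\<dots> \<le> (\<Sum>x\<in>?F. pmult p x + (if pmult p x < k then k - 1 else 0))"
  proof (rule sum_mono)
    show "k \<le> pmult p x + (if pmult p x < k then k - 1 else 0)" for x
      using pmult_pos[OF assms, of x] by (cases "pmult p x < k") auto
  qed
  also have "\<dots> = degree p + (\<Sum>x\<in>?F. if pmult p x < k then k - 1 else 0)"
    using sum_pmult_fibre[OF assms] by (simp add: sum.distrib)
  also have "(\<Sum>x\<in>?F. if pmult p x < k then k - 1 else 0)
      = (\<Sum>x | poly p x = u \<and> pmult p x < k. k - 1)"
    using finite_fibre[OF assms] by (intro sum.mono_neutral_cong_right) auto
  finally show ?thesis by (simp add: mult.commute)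
qed

lemma double_ramif_le:
  assumes "degree p > 0" "\<And>x. poly p x = u \<Longrightarrow> pmult p x \<le> 2"
  shows "2 * ramif p u \<le> degree p"
proof -
  have "(\<Sum>x | poly p x = u. pmult p x) \<le> (\<Sum>x | poly p x = u. 2)"
    using assms(2) by (intro sum_mono) auto
  then show ?thesis
    using card_fibre[OF assms(1), of u] sum_pmult_fibre[OF assms(1), of u] by simp
qed

text \<open>Total ramification at one point: up to affine maps \<open>p\<close> is a power, as made
  explicit in \<open>power_like_eq\<close>.\<close>

definition power_like :: "complex poly \<Rightarrow> bool" where
  "power_like p \<longleftrightarrow> (\<exists>x. pmult p x = degree p)"

text \<open>The ramification type of Chebyshev polynomials.\<close>

definition cheb_like :: "complex poly \<Rightarrow> complex \<Rightarrow> complex \<Rightarrow> bool" where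
  "cheb_like p v w \<longleftrightarrow>
     v \<noteq> w \<and> (\<forall>x. pmult p x \<le> 2) \<and> (\<forall>x. pmult p x = 2 \<longrightarrow> poly p x \<in> {v, w})"

context coprime_composite
begin

text \<open>Over a bad \<open>u\<close> the polynomial \<open>f\<close> has to ramify, so there are few of them.\<close>

definition bad :: "complex \<Rightarrow> bool" where
  "bad u \<longleftrightarrow> (\<exists>y. poly B y = poly A u \<and> \<not> pmult B y dvd pmult A u)"

text \<open>At a common point \<open>x\<close> over \<open>u\<close> and \<open>y\<close>,
  \<open>pmult B y\<close> divides \<open>pmult A u * pmult f x\<close>; so
  \<open>pmult f x = 1\<close> is impossible.\<close>

lemma bad_ramified:
  assumes "bad u"
  shows "ramif f u \<ge> 1"
proof -
  obtain y where y: "poly B y = poly A u" "\<not> pmult B y dvd pmult A u"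
    using assms by (auto simp: bad_def)
  obtain x where x: "poly f x = u" "poly g x = y" using common_point[of u y] y by metis
  have "pmult f x \<noteq> 1" using pmult_chain[of x] y(2) x by fastforce
  then have "pmult f x - 1 \<ge> 1" using pmult_pos[OF f_nonconst, of x] by simp
  then show ?thesis using ramif_ge[OF f_nonconst x(1)] by simp
qed

lemma card_bad:
  assumes "finite U" "\<And>u. u \<in> U \<Longrightarrow> bad u"
  shows "card U \<le> degree f - 1"
proof -
  have "card U \<le> (\<Sum>u\<in>U. ramif f u)"
    using sum_mono[of U "\<lambda>_. 1" "ramif f"] bad_ramified assms by simp
  also have "\<dots> \<le> degree f - 1" by (rule sum_ramif_le[OF f_nonconst assms(1)])
  finally show ?thesis .
qed

lemma bad_over_critical:
  assumes "poly B y = t" "poly A u = t" "pmult A u < pmult B y"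
  shows "bad u"
  using assms pmult_pos[OF A_nonconst, of u] dvd_imp_le unfolding bad_def
  by (metis leD)

text \<open>Over a critical value of \<open>B\<close> each unramified point of \<open>A\<close> is
  bad. The ramification count for \<open>A\<close> gives at least \<open>degree g + 2\<close> such
  points over three values, but fewer than \<open>degree f\<close> points are bad.\<close>

lemma card_critical_values_le_2:
  assumes "degree g \<ge> degree f"
  shows "card (critical_values B) \<le> 2"
proof (rule ccontr)
  assume "\<not> card (critical_values B) \<le> 2"
  then have "card (critical_values B) \<ge> 3" by simp
  then obtain V where V: "V \<subseteq> critical_values B" "card V = 3" "finite V"
    using obtain_subset_with_card_n by metis
  define S where "S t = {u. poly A u = t \<and> pmult A u < 2}" for t
  have finS: "finite (S t)" for t
    using finite_fibre[OF A_nonconst, of t] by (rule rev_finite_subset) (auto simp: S_def)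
  have "card (\<Union>t\<in>V. S t) = (\<Sum>t\<in>V. card (S t))"
    using V(3) finS by (intro card_UN_disjoint) (auto simp: S_def)
  moreover have "card (\<Union>t\<in>V. S t) \<le> degree f - 1"
  proof (rule card_bad)
    show "finite (\<Union>t\<in>V. S t)" using V finS by auto
    show "bad u" if "u \<in> (\<Union>t\<in>V. S t)" for u
    proof -
      have "poly A u \<in> V" "pmult A u < 2" using that by (auto simp: S_def)
      then obtain y where "poly B y = poly A u" "pmult B y \<ge> 2"
        using V(1) by (auto simp: critical_values_def)
      then show ?thesis using bad_over_critical[of y _ u] \<open>pmult A u < 2\<close> by auto
    qed
  qed
  moreover have "(\<Sum>t\<in>V. 2 * card {u. poly A u = t}) \<le> (\<Sum>t\<in>V. degree g + card (S t))"
    using card_fibre_le[OF A_nonconst, of 2] by (intro sum_mono) (simp add: S_def degree_A_eq)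
  ultimately have "2 * (\<Sum>t\<in>V. card {u. poly A u = t}) \<le> 3 * degree g + (degree f - 1)"
    by (simp add: sum.distrib V(2) flip: sum_distrib_left)
  moreover have "3 * degree g \<le> (\<Sum>t\<in>V. card {u. poly A u = t}) + (degree g - 1)"
    using card_fibres_ge[OF A_nonconst V(3)] by (simp add: V(2) degree_A_eq)
  ultimately show False using assms f_nonconst by linarith
qed

text \<open>If \<open>B\<close> had index at least 3 over \<open>t1\<close>, points of index below 3
  over \<open>t1\<close> and below 2 over \<open>t2\<close> would be bad. The counts for
  \<open>A\<close> give \<open>degree g + 6 \<le> 4 * card (P \<union> S)\<close>, whence the factor
  4 in the hypothesis.\<close>

lemma pmult_B_le_2:
  assumes large: "degree g \<ge> 4 * degree f"
    and t: "t1 \<in> critical_values B" "t2 \<in> critical_values B" "t1 \<noteq> t2" and y: "poly B y = t1"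
  shows "pmult B y \<le> 2"
proof (rule ccontr)
  assume "\<not> pmult B y \<le> 2"
  then have y3: "pmult B y \<ge> 3" by simp
  define P where "P = {u. poly A u = t1 \<and> pmult A u < 3}"
  define S where "S = {u. poly A u = t2 \<and> pmult A u < 2}"
  have fin: "finite P" "finite S"
    using finite_fibre[OF A_nonconst] by (auto simp: P_def S_def intro: rev_finite_subset)
  obtain y' where y': "poly B y' = t2" "pmult B y' \<ge> 2" using t by (auto simp: critical_values_def)
  have "card (P \<union> S) \<le> degree f - 1"
  proof (rule card_bad)
    show "bad u" if "u \<in> P \<union> S" for u
      using that bad_over_critical[OF y, of u] bad_over_critical[OF y'(1), of u] y3 y'(2)
      by (auto simp: P_def S_def)
  qed (use fin in auto)
  moreover have "card (P \<union> S) = card P + card S"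
    using fin t(3) by (intro card_Un_disjoint) (auto simp: P_def S_def)
  moreover have "3 * card {u. poly A u = t1} \<le> degree g + 2 * card P"
    using card_fibre_le[OF A_nonconst, of 3 t1] by (simp add: P_def degree_A_eq)
  moreover have "2 * card {u. poly A u = t2} \<le> degree g + card S"
    using card_fibre_le[OF A_nonconst, of 2 t2] by (simp add: S_def degree_A_eq)
  moreover have "2 * degree g \<le> card {u. poly A u = t1} + card {u. poly A u = t2} + (degree g - 1)"
    using card_fibres_ge[OF A_nonconst, of "{t1, t2}"] t(3) by (simp add: degree_A_eq)
  ultimately show False using large f_nonconst by linarith
qed

text \<open>\<open>B\<close> is totally ramified at a single point \<open>b\<close> over
  \<open>t\<close>. Over any \<open>u\<close> in the fibre of \<open>A\<close> whose index is not
  divisible by \<open>n\<close>, \<open>f\<close> ramifies everywhere, so there is at most one such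
  \<open>u\<close>.\<close>

lemma power_like_f:
  assumes "degree f \<ge> 2" "critical_values B = {t}"
  shows "power_like f"
proof -
  define n where "n = degree f"
  have "ramif B t = n - 1"
    using sum_ramif[OF B_nonconst, of "{t}"] assms(2) by (simp add: degree_B_eq n_def)
  then have "card {y. poly B y = t} = 1"
    using card_fibre[OF B_nonconst, of t] assms(1) by (simp add: degree_B_eq n_def)
  then obtain b where b: "{y. poly B y = t} = {b}" by (auto simp: card_1_singleton_iff)
  then have mult_b: "pmult B b = n"
    using sum_pmult_fibre[OF B_nonconst, of t] by (simp add: degree_B_eq n_def)
  have dvd: "n dvd pmult A u * pmult f x" if "poly A u = t" "poly f x = u" for u x
  proof -
    have "poly B (poly g x) = t" using comp_eval[of x] that by simp
    then have "poly g x = b" using b by blast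
    then show ?thesis using pmult_chain[of x] that mult_b by simp
  qed
  define U where "U = {u. poly A u = t \<and> \<not> n dvd pmult A u}"
  have ramU: "n \<le> 2 * ramif f u" if "u \<in> U" for u
  proof -
    have "n = (\<Sum>x | poly f x = u. pmult f x)" using sum_pmult_fibre[OF f_nonconst] by (simp add: n_def)
    also have "\<dots> \<le> (\<Sum>x | poly f x = u. 2 * (pmult f x - 1))"
    proof (rule sum_mono)
      fix x assume x: "x \<in> {x. poly f x = u}"
      have "pmult f x \<noteq> 1" using dvd[of u x] x that by (auto simp: U_def)
      then have "pmult f x \<ge> 2" using pmult_pos[OF f_nonconst, of x] by linarith
      then show "pmult f x \<le> 2 * (pmult f x - 1)" by linarith
    qed
    finally show ?thesis by (simp add: ramif_def flip: sum_distrib_left)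
  qed
  have uniq: "u = u'" if "u \<in> U" "u' \<in> U" for u u'
  proof (rule ccontr)
    assume "u \<noteq> u'"
    then have "ramif f u + ramif f u' \<le> n - 1"
      using sum_ramif_le[OF f_nonconst, of "{u, u'}"] by (simp add: n_def)
    then show False using ramU[OF that(1)] ramU[OF that(2)] assms(1) by (simp add: n_def)
  qed
  have sumA: "(\<Sum>u | poly A u = t. pmult A u) = degree g"
    using sum_pmult_fibre[OF A_nonconst] by (simp add: degree_A_eq)
  have ndvd: "\<not> n dvd degree g"
    using coprime_degrees assms(1) coprime_common_divisor_nat[of n "degree g" n] by (auto simp: n_def)
  obtain u where u: "u \<in> U"
  proof (cases "U = {}")
    case True
    then have "n dvd (\<Sum>u | poly A u = t. pmult A u)" by (intro dvd_sum) (auto simp: U_def)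
    then show ?thesis using ndvd sumA by simp
  qed (use that in auto)
  have "(\<Sum>u | poly A u = t. pmult A u) = pmult A u + (\<Sum>u'\<in>{u. poly A u = t} - {u}. pmult A u')"
    using u finite_fibre[OF A_nonconst] by (intro sum.remove) (auto simp: U_def)
  moreover have "n dvd (\<Sum>u'\<in>{u. poly A u = t} - {u}. pmult A u')"
    using uniq[OF u] by (intro dvd_sum) (auto simp: U_def)
  \<comment> \<open>All other indices are multiples of \<open>n\<close>, so \<open>pmult A u\<close>
    is congruent to \<open>degree g\<close> modulo \<open>n\<close> and hence coprime to
    \<open>n\<close>.\<close>
  ultimately obtain k where k: "degree g = pmult A u + n * k" using sumA by (auto elim!: dvdE)
  then have "gcd n (degree g) = gcd n (pmult A u)"
    by (metis gcd_add_mult add.commute mult.commute)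
  then have cop: "coprime n (pmult A u)"
    using coprime_degrees by (simp add: n_def coprime_iff_gcd_eq_1)
  obtain x where x: "poly f x = u" using poly_surj[OF f_nonconst] by blast
  have "n dvd pmult f x" using dvd[OF _ x] u cop by (simp add: U_def coprime_dvd_mult_right_iff)
  then have "pmult f x = n"
    using pmult_pos[OF f_nonconst, of x] pmult_le_degree[OF f_nonconst, of x] dvd_imp_le
    by (fastforce simp: n_def)
  then show ?thesis by (auto simp: power_like_def n_def)
qed

section \<open>Two critical values: the Chebyshev case\<close>

lemma pmult_f_le:
  "pmult f x \<le> pmult B (poly g x)"
proof -
  have "finite {x'. poly f x' = poly f x \<and> poly g x' = poly g x}"
    using finite_fibre[OF f_nonconst, of "poly f x"] by (rule rev_finite_subset) auto
  then have "pmult f x \<le> (\<Sum>x' | poly f x' = poly f x \<and> poly g x' = poly g x. pmult f x')"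
    by (intro member_le_sum) auto
  then show ?thesis using sum_pmult_common_points comp_eval by simp
qed

text \<open>Over a double point \<open>y\<close> of \<open>B\<close>, the index of \<open>f\<close>
  at a common point must be even because that of \<open>A\<close> is odd. Distinct \<open>y\<close>
  give distinct common points, as \<open>g\<close> recovers \<open>y\<close>.\<close>

lemma ramif_f_odd:
  assumes u: "poly A u = t" "odd (pmult A u)" and le2: "\<And>y. poly B y = t \<Longrightarrow> pmult B y \<le> 2"
  shows "ramif B t \<le> ramif f u"
proof -
  define Y where "Y = {y. poly B y = t \<and> pmult B y = 2}"
  have "\<exists>x. poly f x = u \<and> poly g x = y \<and> pmult f x \<ge> 2" if "y \<in> Y" for y
  proof -
    have y: "poly B y = t" "pmult B y = 2" using that by (auto simp: Y_def)
    then have "poly A u = poly B y" using u by simp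
    then obtain x where x: "poly f x = u" "poly g x = y" by (rule common_point)
    have "pmult A u * pmult f x = 2 * pmult g x" using pmult_chain[of x] x y by simp
    then have "even (pmult A u * pmult f x)" by simp
    then have "even (pmult f x)" using u(2) by simp
    then have "pmult f x \<ge> 2" using pmult_pos[OF f_nonconst, of x] by presburger
    with x show ?thesis by blast
  qed
  then obtain h where h: "\<And>y. y \<in> Y \<Longrightarrow> poly f (h y) = u \<and> poly g (h y) = y \<and> pmult f (h y) \<ge> 2"
    by metis
  have inj: "inj_on h Y" by (rule inj_on_inverseI[where g = "poly g"]) (use h in blast)
  have hY: "h ` Y \<subseteq> {x. poly f x = u}" using h by blast
  have "ramif B t = (\<Sum>y\<in>Y. 1)"
    unfolding ramif_def
  proof (rule sum.mono_neutral_cong_right)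
    show "finite {x. poly B x = t}" by (rule finite_fibre[OF B_nonconst])
    show "\<forall>y\<in>{x. poly B x = t} - Y. pmult B y - 1 = 0"
    proof
      fix y assume "y \<in> {x. poly B x = t} - Y"
      then show "pmult B y - 1 = 0" using le2[of y] by (auto simp: Y_def)
    qed
  qed (auto simp: Y_def)
  also have "\<dots> \<le> (\<Sum>y\<in>Y. pmult f (h y) - 1)" using h by (intro sum_mono) force
  also have "\<dots> = (\<Sum>x\<in>h ` Y. pmult f x - 1)"
    by (subst sum.reindex[OF inj]) simp
  also have "\<dots> \<le> ramif f u"
    unfolding ramif_def using hY finite_fibre[OF f_nonconst] by (intro sum_mono2) auto
  finally show ?thesis .
qed

text \<open>The count for \<open>A\<close> yields at least two points of odd index over
  \<open>t1\<close> and \<open>t2\<close>. One over each value absorbs all ramification of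
  \<open>B\<close>. If all lie over one value, \<open>degree g\<close> is even, so
  \<open>degree f\<close> is odd; the ramification over that value is then at least half of the
  total and can be used twice.\<close>

lemma two_odd_points:
  assumes t: "critical_values B = {t1, t2}" "t1 \<noteq> t2"
    and le2: "\<And>y. poly B y \<in> {t1, t2} \<Longrightarrow> pmult B y \<le> 2"
  obtains u v where "u \<noteq> v" "ramif f u + ramif f v \<ge> degree f - 1"
proof -
  define O' where "O' t = {u. poly A u = t \<and> odd (pmult A u)}" for t
  have fin: "finite (O' t)" for t
    using finite_fibre[OF A_nonconst, of t] by (rule rev_finite_subset) (auto simp: O'_def)
  have ram: "ramif B t1 + ramif B t2 = degree f - 1"
    using sum_ramif[OF B_nonconst, of "{t1, t2}"] t by (simp add: degree_B_eq)
  have ramO: "ramif B t \<le> ramif f u" if "u \<in> O' t" "t \<in> {t1, t2}" for u t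
    using that le2 by (intro ramif_f_odd[of u t]) (auto simp: O'_def)
  have half: "2 * card {u. poly A u = t} \<le> degree g + card (O' t)" for t
  proof -
    have "{u. poly A u = t \<and> pmult A u < 2} \<subseteq> O' t"
    proof
      fix u assume "u \<in> {u. poly A u = t \<and> pmult A u < 2}"
      then have "poly A u = t" "pmult A u = 1" using pmult_pos[OF A_nonconst, of u] by auto
      then show "u \<in> O' t" by (simp add: O'_def)
    qed
    then have "card {u. poly A u = t \<and> pmult A u < 2} \<le> card (O' t)" using fin by (rule card_mono[rotated])
    then show ?thesis using card_fibre_le[OF A_nonconst, of 2 t] by (simp add: degree_A_eq)
  qed
  have "2 * degree g \<le> card {u. poly A u = t1} + card {u. poly A u = t2} + (degree g - 1)"
    using card_fibres_ge[OF A_nonconst, of "{t1, t2}"] t(2) by (simp add: degree_A_eq)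
  then have two: "card (O' t1) + card (O' t2) \<ge> 2"
    using half[of t1] half[of t2] g_nonconst by linarith
  note goal = that
  have one_sided: thesis
    if s: "{s1, s2} = {t1, t2}" "s1 \<noteq> s2" and empty: "O' s1 = {}" for s1 s2
  proof -
    have sums: "card (O' s1) + card (O' s2) \<ge> 2" "ramif B s1 + ramif B s2 = degree f - 1"
      using s t(2) two ram by (auto simp: doubleton_eq_iff add.commute)
    then have "card (O' s2) \<ge> 2" using empty by simp
    then obtain U where "U \<subseteq> O' s2" "card U = 2" using obtain_subset_with_card_n by metis
    then obtain u v where uv: "u \<in> O' s2" "v \<in> O' s2" "u \<noteq> v" by (auto simp: card_2_iff)
    have "even (\<Sum>u | poly A u = s1. pmult A u)" using empty by (intro dvd_sum) (auto simp: O'_def)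
    then have "even (degree g)" using sum_pmult_fibre[OF A_nonconst] by (simp add: degree_A_eq)
    then have "odd (degree f)" using coprime_degrees coprime_common_divisor_nat[of _ _ 2] by fastforce
    have "2 * ramif B s1 \<le> degree f"
      using double_ramif_le[OF B_nonconst, of s1] le2 s by (auto simp: degree_B_eq)
    then have "2 * ramif B s1 \<le> degree f - 1" using \<open>odd (degree f)\<close> by presburger
    moreover have "ramif B s2 \<le> ramif f u" "ramif B s2 \<le> ramif f v"
      using uv s by (auto intro!: ramO)
    ultimately show thesis using goal[OF uv(3)] sums(2) by linarith
  qed
  show thesis
  proof (cases "O' t1 = {} \<or> O' t2 = {}")
    case True
    then show thesis using one_sided[of t1 t2] one_sided[of t2 t1] t(2) by auto
  next
    case False
    then obtain u v where uv: "u \<in> O' t1" "v \<in> O' t2" by blast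
    then have "u \<noteq> v" using t(2) by (auto simp: O'_def)
    moreover have "ramif f u + ramif f v \<ge> degree f - 1"
      using ramO[OF uv(1)] ramO[OF uv(2)] ram by simp
    ultimately show thesis by (rule that)
  qed
qed

text \<open>The two points \<open>u\<close>, \<open>v\<close> already account for the whole
  ramification of \<open>f\<close>, so nothing is left over other values.\<close>

lemma cheb_like_f:
  assumes t: "critical_values B = {t1, t2}" "t1 \<noteq> t2"
    and le2: "\<And>y. poly B y \<in> {t1, t2} \<Longrightarrow> pmult B y \<le> 2"
  obtains v w where "cheb_like f v w"
proof -
  obtain u v where uv: "u \<noteq> v" "ramif f u + ramif f v \<ge> degree f - 1"
    using two_odd_points[OF assms] by metis
  have "pmult B y \<le> 2" for y
  proof (cases "pmult B y \<ge> 2")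
    case True
    then have "poly B y \<in> {t1, t2}" using t(1) by (auto simp: critical_values_def)
    then show ?thesis by (rule le2)
  qed simp
  then have f2: "pmult f x \<le> 2" for x using pmult_f_le[of x] order_trans by blast
  have "poly f x \<in> {u, v}" if "pmult f x = 2" for x
  proof (rule ccontr)
    assume "poly f x \<notin> {u, v}"
    then have "ramif f (poly f x) + (ramif f u + ramif f v) \<le> degree f - 1"
      using sum_ramif_le[OF f_nonconst, of "{poly f x, u, v}"] uv(1) by simp
    moreover have "ramif f (poly f x) \<ge> 1" using ramif_ge[OF f_nonconst, of x] that by simp
    ultimately show False using uv(2) by linarith
  qed
  with f2 uv(1) that[of u v] show thesis by (simp add: cheb_like_def)
qed

text \<open>A weak form of Ritt's second theorem.\<close>

lemma power_or_cheb_like: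
  assumes "degree f \<ge> 2" "degree g \<ge> 4 * degree f"
  shows "power_like f \<or> (\<exists>v w. cheb_like f v w)"
proof -
  have fin: "finite (critical_values B)" by (rule finite_critical_values[OF B_nonconst])
  have "card (critical_values B) \<noteq> 0"
    using sum_ramif[OF B_nonconst fin order_refl] assms(1) fin by (auto simp: degree_B_eq)
  moreover have "card (critical_values B) \<le> 2" using assms(2) by (intro card_critical_values_le_2) simp
  ultimately consider "card (critical_values B) = 1" | "card (critical_values B) = 2" by linarith
  then show ?thesis
  proof cases
    case 1
    then show ?thesis using power_like_f[OF assms(1)] by (auto simp: card_1_singleton_iff)
  next
    case 2
    then obtain t1 t2 where t: "critical_values B = {t1, t2}" "t1 \<noteq> t2" by (auto simp: card_2_iff)
    have "pmult B y \<le> 2" if "poly B y \<in> {t1, t2}" for y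
      using that pmult_B_le_2[OF assms(2), of t1 t2 y] pmult_B_le_2[OF assms(2), of t2 t1 y] t by auto
    from cheb_like_f[OF t this] show ?thesis by blast
  qed
qed

end

section \<open>Power-like polynomials\<close>

lemma power_like_eq:
  assumes "degree p > 0" "pmult p a = degree p"
  obtains k where "\<And>x. poly p x = poly p a + k * (x - a) ^ degree p"
proof -
  define n where "n = degree p"
  have nz: "p - [:poly p a:] \<noteq> 0" using assms(1) by simp
  have "[:-a, 1:] ^ n dvd p - [:poly p a:]"
    using assms(2) order_1[of a "p - [:poly p a:]"] by (simp add: pmult_def n_def)
  then obtain q where q: "p - [:poly p a:] = [:-a, 1:] ^ n * q" by (elim dvdE)
  have "q \<noteq> 0" using q nz by auto
  have "degree (p - [:poly p a:]) = n + degree q"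
    unfolding q using \<open>q \<noteq> 0\<close> by (subst degree_mult_eq) (auto simp: degree_power_eq)
  then have "degree q = 0" using assms(1) by (simp add: n_def)
  then obtain k where k: "q = [:k:]" by (rule degree_eq_zeroE)
  have "poly p x = poly p a + k * (x - a) ^ n" for x
    using arg_cong[OF q, of "\<lambda>p. poly p x"] k by (simp add: poly_power algebra_simps)
  then show thesis unfolding n_def by (rule that)
qed

lemma rotation_image_saturated:
  assumes "saturated K p" "\<And>x. poly p (c + w * (x - c)) = poly p x" "w \<noteq> 0"
  shows "(\<lambda>x. c + w * (x - c)) ` K = K"
proof
  show "(\<lambda>x. c + w * (x - c)) ` K \<subseteq> K"
    using assms(1,2) unfolding saturated_def by (auto; metis)
  show "K \<subseteq> (\<lambda>x. c + w * (x - c)) ` K"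
  proof
    fix y assume "y \<in> K"
    define x where "x = c + (y - c) / w"
    have y: "y = c + w * (x - c)" using assms(3) by (simp add: x_def)
    then have "poly p y = poly p x" using assms(2)[of x] by simp
    then have "x \<in> K" using assms(1) \<open>y \<in> K\<close> unfolding saturated_def by blast
    then show "y \<in> (\<lambda>x. c + w * (x - c)) ` K" using y by blast
  qed
qed

text \<open>Rotation by \<open>2 * pi / degree p\<close> about the totally ramified point preserves
  \<open>p\<close>, hence every set saturated for it.\<close>

lemma power_like_rotation:
  assumes "saturated K p" "power_like p" "degree p \<ge> 2"
  shows "\<exists>R. is_rotation R \<and> R \<noteq> id \<and> R ` K = K"
proof -
  obtain a where a: "pmult p a = degree p" using assms(2) by (auto simp: power_like_def)
  obtain k where k: "\<And>x. poly p x = poly p a + k * (x - a) ^ degree p"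
    using power_like_eq[OF _ a] assms(3) by auto
  define t where "t = 2 * pi / degree p"
  define w where "w = exp (\<i> * complex_of_real t)"
  define R where "R = (\<lambda>x. a + w * (x - a))"
  have "w ^ degree p = exp (of_nat (degree p) * (\<i> * complex_of_real t))"
    unfolding w_def by (rule exp_of_nat_mult[symmetric])
  also have "of_nat (degree p) * (\<i> * complex_of_real t) = 2 * complex_of_real pi * \<i>"
    using assms(3) by (simp add: t_def field_simps)
  finally have w1: "w ^ degree p = 1" by (simp only: exp_two_pi_i)
  have inv: "poly p (R x) = poly p x" for x
    using k[of "R x"] k[of x] w1 by (simp add: R_def power_mult_distrib)
  have "w \<noteq> 1"
  proof
    assume "w = 1"
    then obtain n :: int where "t = of_int (2 * n) * pi" by (auto simp: w_def exp_eq_1)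
    then have "1 = of_int n * real (degree p)" using assms(3) by (simp add: t_def field_simps)
    then have "1 = n * int (degree p)" by (metis of_int_1 of_int_eq_iff of_int_mult of_int_of_nat_eq)
    then show False using assms(3) by (metis dvd_triv_right int_dvd_int_iff of_nat_1 nat_dvd_1_iff_1 numeral_le_one_iff semiring_norm(69))
  qed
  then have "R (a + 1) \<noteq> id (a + 1)" by (simp add: R_def)
  then have "R \<noteq> id" by metis
  moreover have "is_rotation R" unfolding is_rotation_def R_def w_def by blast
  moreover have "R ` K = K"
    unfolding R_def by (rule rotation_image_saturated[OF assms(1)]) (use inv in \<open>auto simp: R_def w_def\<close>)
  ultimately show ?thesis by blast
qed

lemma degree_2_power_like:
  assumes "degree p = 2"
  shows "power_like p"
proof -
  have p: "degree p > 0" using assms by simp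
  have "{x. pmult p x > 1} \<noteq> {}"
  proof
    assume "{x. pmult p x > 1} = {}"
    then show False using sum_ramification[OF p, of "{}"] assms by simp
  qed
  then obtain x where "pmult p x > 1" by blast
  then have "pmult p x = degree p" using pmult_le_degree[OF p, of x] assms by simp
  then show ?thesis by (auto simp: power_like_def)
qed

section \<open>Chebyshev-like polynomials\<close>

text \<open>For a Chebyshev polynomial with values \<open>v\<close>, \<open>w\<close> equal to 1 and
  -1 these are the end points 1 and -1 of the real interval.\<close>

definition special_points :: "complex poly \<Rightarrow> complex \<Rightarrow> complex \<Rightarrow> complex set" where
  "special_points p v w = {x. poly p x \<in> {v, w} \<and> pmult p x = 1}"

lemma cheb_like_ramif:
  assumes "degree p > 0" "cheb_like p v w"
  shows "ramif p v + ramif p w = degree p - 1"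
proof -
  have "critical_values p \<subseteq> {v, w}"
  proof
    fix u assume "u \<in> critical_values p"
    then obtain x where x: "poly p x = u" "pmult p x \<ge> 2" by (auto simp: critical_values_def)
    then have "pmult p x = 2" using assms(2) by (metis cheb_like_def le_antisym)
    then show "u \<in> {v, w}" using assms(2) x by (auto simp: cheb_like_def)
  qed
  then show ?thesis using sum_ramif[OF assms(1), of "{v, w}"] assms(2) by (simp add: cheb_like_def)
qed

text \<open>The two fibres have \<open>degree p + 1\<close> points together, of which
  \<open>degree p - 1\<close> are double.\<close>

lemma card_special_points:
  assumes p: "degree p > 0" and c: "cheb_like p v w"
  shows "card (special_points p v w) = 2"
proof -
  have vw: "v \<noteq> w" and le2: "\<And>x. pmult p x \<le> 2" using c by (auto simp: cheb_like_def)
  define X where "X = {x. poly p x = v} \<union> {x. poly p x = w}"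
  have fin: "finite X" using finite_fibre[OF p] by (simp add: X_def)
  have cardX: "card X = card {x. poly p x = v} + card {x. poly p x = w}"
    unfolding X_def using vw finite_fibre[OF p] by (intro card_Un_disjoint) auto
  have ram: "(\<Sum>x\<in>X. pmult p x - 1) = ramif p v + ramif p w"
    unfolding X_def ramif_def using vw finite_fibre[OF p] by (intro sum.union_disjoint) auto
  have "card (special_points p v w) = (\<Sum>x\<in>special_points p v w. 1)" by simp
  also have "\<dots> = (\<Sum>x\<in>X. 1 - (pmult p x - 1))"
    using fin
  proof (intro sum.mono_neutral_cong_left ballI)
    fix x assume "x \<in> X - special_points p v w"
    then have "pmult p x \<noteq> 1" by (auto simp: X_def special_points_def)
    then show "1 - (pmult p x - 1) = 0" using pmult_pos[OF p, of x] by simp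
  qed (auto simp: X_def special_points_def)
  also have "\<dots> = (\<Sum>x\<in>X. 1) - (\<Sum>x\<in>X. pmult p x - 1)"
  proof (rule sum_subtractf_nat)
    show "pmult p x - 1 \<le> 1" for x using le2[of x] by simp
  qed
  also have "\<dots> = 2"
    using card_fibre[OF p, of v] card_fibre[OF p, of w] cheb_like_ramif[OF p c] p
    by (simp add: cardX ram[unfolded One_nat_def])
  finally show ?thesis .
qed

text \<open>Each fibre carries at most half of \<open>degree p\<close> as ramification, so from
  degree 3 on one fibre alone cannot carry \<open>degree p - 1\<close>.\<close>

lemma cheb_like_critical_point:
  assumes p: "degree p \<ge> 3" and c: "cheb_like p v w" and u: "u \<in> {v, w}"
  obtains x where "poly p x = u" "pmult p x = 2"
proof -
  have p0: "degree p > 0" using p by simp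
  have le2: "\<And>x. pmult p x \<le> 2" using c by (auto simp: cheb_like_def)
  have "2 * ramif p v \<le> degree p" "2 * ramif p w \<le> degree p"
    using double_ramif_le[OF p0] le2 by auto
  then have "ramif p u \<noteq> 0" using cheb_like_ramif[OF p0 c] p u by auto
  then obtain x where "poly p x = u" "pmult p x - 1 \<noteq> 0"
    unfolding ramif_def by (metis (mono_tags, lifting) mem_Collect_eq sum.neutral)
  then show thesis using that[of x] le2[of x] by simp
qed

text \<open>A double point of \<open>f\<close> over \<open>u\<close> leaves no room for ramification
  of \<open>h\<close> at \<open>u\<close>, and sends \<open>u\<close> into \<open>{v', w'}\<close>.
  So special points of \<open>f\<close> stay special, and both sets have two elements. This gives
  all composites one common normalization.\<close>

lemma special_points_pcompose:
  assumes f: "degree f \<ge> 3" "cheb_like f v w"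
    and h: "degree h > 0" "cheb_like (pcompose h f) v' w'"
  shows "special_points (pcompose h f) v' w' = special_points f v w"
proof -
  have f0: "degree f > 0" using f by simp
  have hf: "degree (pcompose h f) > 0" using f0 h by (simp add: degree_pcompose)
  have crit: "pmult h u = 1 \<and> poly h u \<in> {v', w'}" if u: "u \<in> {v, w}" for u
  proof -
    obtain x where x: "poly f x = u" "pmult f x = 2"
      by (rule cheb_like_critical_point[OF f u])
    have eq: "pmult (pcompose h f) x = pmult h u * 2"
      using pmult_pcompose[OF f0 h(1), of x] x by simp
    moreover have "pmult (pcompose h f) x \<le> 2" using h(2) by (simp add: cheb_like_def)
    ultimately have "pmult h u = 1" using pmult_pos[OF h(1), of u] by linarith
    moreover have "poly (pcompose h f) x \<in> {v', w'}"
      using h(2) eq calculation by (simp add: cheb_like_def)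
    ultimately show ?thesis using x by (simp add: poly_pcompose)
  qed
  have sub: "special_points f v w \<subseteq> special_points (pcompose h f) v' w'"
  proof
    fix x assume "x \<in> special_points f v w"
    then have "poly f x \<in> {v, w}" "pmult f x = 1" by (auto simp: special_points_def)
    then show "x \<in> special_points (pcompose h f) v' w'"
      using crit[of "poly f x"] pmult_pcompose[OF f0 h(1), of x]
      by (auto simp: special_points_def poly_pcompose)
  qed
  have "finite (special_points (pcompose h f) v' w')"
    using card_special_points[OF hf h(2)] card.infinite by fastforce
  from card_subset_eq[OF this sub] show ?thesis
    using card_special_points[OF hf h(2)] card_special_points[OF f0 f(2)] by simp
qed

section \<open>The Chebyshev differential equation and the resulting periodicity\<close>

lemma poly_eqI_order:
  fixes p q :: "complex poly"
  assumes "p \<noteq> 0" "q \<noteq> 0" "lead_coeff p = lead_coeff q" "\<And>x. order x p = order x q"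
  shows "p = q"
proof -
  have "proots p = proots q" using assms by (intro multiset_eqI) simp
  then show ?thesis
    using complex_poly_decompose_multiset[of p] complex_poly_decompose_multiset[of q] assms(3) by metis
qed

lemma order_linear: "order x [:-a, 1:] = (if x = a then 1 else 0)" for a :: complex
  using order_power_n_n[of a 1] by (auto intro: order_0I)

text \<open>The differential equation \<open>(1 - x\<^sup>2) T'\<^sup>2 = n\<^sup>2 (1 - T\<^sup>2)\<close> of the Chebyshev polynomials.\<close>

lemma cheb_like_ode:
  assumes p: "degree p > 0" and c: "cheb_like p v w" and z: "special_points p v w = {z1, z2}"
  shows "pderiv p ^ 2 * ([:-z1, 1:] * [:-z2, 1:])
    = smult (of_nat (degree p ^ 2)) ((p - [:v:]) * (p - [:w:]))"
proof (rule poly_eqI_order)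
  have vw: "v \<noteq> w" using c by (simp add: cheb_like_def)
  have z12: "z1 \<noteq> z2" using card_special_points[OF p c] z by auto
  have p': "pderiv p \<noteq> 0" using p by (auto simp: pderiv_eq_0_iff)
  have pv: "p - [:v:] \<noteq> 0" "p - [:w:] \<noteq> 0" using p by auto
  have nz: "[:-z1, 1:] * [:-z2, 1:] \<noteq> (0 :: complex poly)" by (metis mult_eq_0_iff one_neq_zero pCons_eq_0_iff)
  have nz': "(p - [:v:]) * (p - [:w:]) \<noteq> 0" using pv by (metis mult_eq_0_iff)
  have nz'': "pderiv p ^ 2 \<noteq> 0" using p' by simp
  show "pderiv p ^ 2 * ([:-z1, 1:] * [:-z2, 1:]) \<noteq> 0" using nz nz'' by (metis mult_eq_0_iff)
  show "smult (of_nat (degree p ^ 2)) ((p - [:v:]) * (p - [:w:])) \<noteq> 0"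
    using nz' p by (metis smult_eq_0_iff of_nat_eq_0_iff power_not_zero less_not_refl)
  have lc: "lead_coeff (p - [:u:]) = lead_coeff p" for u
    using p by (cases "degree p") (auto simp: coeff_pCons)
  have "lead_coeff (pderiv p) = of_nat (degree p) * lead_coeff p"
    using p by (simp add: degree_pderiv coeff_pderiv)
  then show "lead_coeff (pderiv p ^ 2 * ([:-z1, 1:] * [:-z2, 1:]))
      = lead_coeff (smult (of_nat (degree p ^ 2)) ((p - [:v:]) * (p - [:w:])))"
    unfolding lead_coeff_mult lead_coeff_smult lead_coeff_power lc
    by (simp add: power2_eq_square algebra_simps)
  show "order x (pderiv p ^ 2 * ([:-z1, 1:] * [:-z2, 1:]))
      = order x (smult (of_nat (degree p ^ 2)) ((p - [:v:]) * (p - [:w:])))" for x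
  proof -
    have "order x (pderiv p ^ 2 * ([:-z1, 1:] * [:-z2, 1:]))
        = 2 * (pmult p x - 1) + (if x \<in> {z1, z2} then 1 else 0)"
      using nz nz'' p' z12 p
      by (subst order_mult, metis mult_eq_0_iff, subst order_mult)
        (auto simp: order_power_poly order_linear pmult_pderiv simp del: mult_pCons_left mult_pCons_right)
    also have "\<dots> = (if poly p x \<in> {v, w} then pmult p x else 0)"
    proof (cases "pmult p x = 1")
      case True
      then show ?thesis unfolding z[symmetric] special_points_def by simp
    next
      case False
      then have "pmult p x = 2"
        using c pmult_pos[OF p, of x] unfolding cheb_like_def by (metis One_nat_def Suc_1 le_SucE le_less_Suc_eq less_one linorder_not_less not_less_eq_eq)
      then show ?thesis using c unfolding z[symmetric] special_points_def cheb_like_def by simp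
    qed
    also have "\<dots> = order x (p - [:v:]) + order x (p - [:w:])"
      using vw pv by (auto simp: pmult_def order_0I)
    also have "\<dots> = order x (smult (of_nat (degree p ^ 2)) ((p - [:v:]) * (p - [:w:])))"
      using nz' p by (subst order_smult) (auto simp: order_mult)
    finally show ?thesis .
  qed
qed

text \<open>Differentiate the first order equation and cancel \<open>pderiv p\<close>; the result is
  linear.\<close>

lemma cheb_like_ode2:
  assumes p: "degree p > 0" and c: "cheb_like p v w" and z: "special_points p v w = {z1, z2}"
  shows "2 * poly (pderiv (pderiv p)) x * ((x - z1) * (x - z2)) + poly (pderiv p) x * (2 * x - z1 - z2)
    = of_nat (degree p) ^ 2 * (2 * poly p x - v - w)"
proof -
  define Q where "Q = [:-z1, 1:] * [:-z2, 1:]"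
  have Q: "poly Q x = (x - z1) * (x - z2)" "poly (pderiv Q) x = 2 * x - z1 - z2" for x
    by (simp_all add: Q_def pderiv_pCons pderiv_mult algebra_simps)
  have p': "pderiv p \<noteq> 0" using p by (auto simp: pderiv_eq_0_iff)
  have ode: "pderiv p ^ 2 * Q = smult (of_nat (degree p ^ 2)) ((p - [:v:]) * (p - [:w:]))"
    using cheb_like_ode[OF assms] by (simp only: Q_def)
  define k :: complex where "k = of_nat (degree p) ^ 2"
  define L where "L = 2 * pderiv (pderiv p) * Q + pderiv p * pderiv Q"
  define M where "M = smult k (2 * p - [:v + w:])"
  have "pderiv (pderiv p ^ 2 * Q) = pderiv p * L"
    by (simp add: L_def pderiv_mult power2_eq_square algebra_simps)
  moreover have "pderiv (smult k ((p - [:v:]) * (p - [:w:]))) = pderiv p * M"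
  proof -
    have "poly (pderiv (smult k ((p - [:v:]) * (p - [:w:])))) y = poly (pderiv p * M) y" for y
      unfolding pderiv_smult pderiv_mult pderiv_diff pderiv_singleton
      by (simp add: M_def algebra_simps)
    then show ?thesis by (simp add: fun_eq_iff flip: poly_eq_poly_eq_iff)
  qed
  ultimately have "pderiv p * L = pderiv p * M" using ode by (simp add: k_def)
  then have "L = M" using p' by simp
  from arg_cong[OF this, of "\<lambda>q. poly q x"] show ?thesis
    by (simp add: L_def M_def Q k_def algebra_simps)
qed

lemma harmonic_ode_periodic:
  fixes H G :: "complex \<Rightarrow> complex"
  assumes n: "n > 0"
    and H: "\<And>t. (H has_field_derivative G t) (at t)"
    and G: "\<And>t. (G has_field_derivative - (of_nat n)\<^sup>2 * H t) (at t)"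
  shows "H (t + 2 * of_real pi / of_nat n) = H t"
proof -
  define N :: complex where "N = of_nat n"
  have N: "N \<noteq> 0" using n by (simp add: N_def)
  define c where "c = inverse N"
  have c: "N * c = 1" using N by (simp add: c_def)
  \<comment> \<open>\<open>E1\<close> and \<open>E2\<close> are the candidates for the coefficients
    of cosine and sine; the equation makes their derivatives vanish.\<close>
  define E1 where "E1 t = H t * cos (N * t) - G t * sin (N * t) * c" for t
  define E2 where "E2 t = H t * sin (N * t) + G t * cos (N * t) * c" for t
  note [derivative_intros] = H G[folded N_def]
  have "(E1 has_field_derivative H t * (- sin (N * t) * N) + G t * cos (N * t)
      - (G t * (cos (N * t) * N) + - N\<^sup>2 * H t * sin (N * t)) * c) (at t)" for t
    unfolding E1_def by (rule derivative_eq_intros refl)+ (simp add: algebra_simps)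
  moreover have "H t * (- sin (N * t) * N) + G t * cos (N * t)
      - (G t * (cos (N * t) * N) + - N\<^sup>2 * H t * sin (N * t)) * c = 0" for t
    using c by algebra
  ultimately have "(E1 has_field_derivative 0) (at t)" for t by simp
  then obtain a where a: "\<And>t. E1 t = a"
    using has_field_derivative_zero_constant[of UNIV E1] by auto
  have "(E2 has_field_derivative H t * (cos (N * t) * N) + G t * sin (N * t)
      + (G t * (- sin (N * t) * N) + - N\<^sup>2 * H t * cos (N * t)) * c) (at t)" for t
    unfolding E2_def by (rule derivative_eq_intros refl)+ (simp add: algebra_simps)
  moreover have "H t * (cos (N * t) * N) + G t * sin (N * t)
      + (G t * (- sin (N * t) * N) + - N\<^sup>2 * H t * cos (N * t)) * c = 0" for t
    using c by algebra
  ultimately have "(E2 has_field_derivative 0) (at t)" for t by simp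
  then obtain b where b: "\<And>t. E2 t = b"
    using has_field_derivative_zero_constant[of UNIV E2] by auto
  have sol: "H t = a * cos (N * t) + b * sin (N * t)" for t
  proof -
    have "a * cos (N * t) + b * sin (N * t)
        = H t * (cos (N * t) * cos (N * t) + sin (N * t) * sin (N * t))"
      unfolding a[symmetric, of t] b[symmetric, of t] E1_def E2_def by algebra
    also have "cos (N * t) * cos (N * t) + sin (N * t) * sin (N * t) = 1" by simp
    finally show ?thesis by simp
  qed
  have per: "N * (t + 2 * of_real pi / N) = N * t + 2 * of_real pi" using N by (simp add: field_simps)
  have "cos (N * t + 2 * of_real pi) = cos (N * t)" "sin (N * t + 2 * of_real pi) = sin (N * t)"
  proof -
    have "cos (of_real (2 * pi)) = (1 :: complex)" "sin (of_real (2 * pi)) = (0 :: complex)"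
      by (simp_all only: cos_of_real sin_of_real cos_two_pi sin_two_pi of_real_1 of_real_0)
    then show "cos (N * t + 2 * of_real pi) = cos (N * t)" "sin (N * t + 2 * of_real pi) = sin (N * t)"
      by (simp_all add: cos_add sin_add)
  qed
  then show ?thesis using sol[of t] sol[of "t + 2 * of_real pi / N"] per by (simp add: N_def)
qed

text \<open>The substitution \<open>x = m + d * cos t\<close>, which sends 0 and pi to the special
  points, turns the second order equation into that of a harmonic oscillator.\<close>

lemma cheb_like_periodic:
  assumes p: "degree p > 0" and c: "cheb_like p v w" and z: "special_points p v w = {z1, z2}"
  defines "m \<equiv> (z1 + z2) / 2" and "d \<equiv> (z1 - z2) / 2"
  shows "poly p (m + d * cos (t + 2 * of_real pi / of_nat (degree p))) = poly p (m + d * cos t)"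
proof -
  \<comment> \<open>Subtracting the midpoint of \<open>v\<close> and \<open>w\<close> makes the
    equation homogeneous.\<close>
  define H where "H t = poly p (m + d * cos t) - (v + w) / 2" for t
  define G where "G t = poly (pderiv p) (m + d * cos t) * (- d * sin t)" for t
  have "(H has_field_derivative G t) (at t)" for t
    unfolding H_def G_def
    by (rule derivative_eq_intros refl DERIV_chain2[OF poly_DERIV])+ simp
  moreover have "(G has_field_derivative - (of_nat (degree p))\<^sup>2 * H t) (at t)" for t
  proof -
    define x where "x = m + d * cos t"
    have q: "(x - z1) * (x - z2) = - (d\<^sup>2 * (sin t)\<^sup>2)" "2 * x - z1 - z2 = 2 * (d * cos t)"
    proof -
      have z12: "z1 = m + d" "z2 = m - d" by (simp_all add: m_def d_def field_simps)
      have "(x - z1) * (x - z2) = d\<^sup>2 * ((cos t)\<^sup>2 - 1)"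
        unfolding x_def z12 by (simp add: power2_eq_square algebra_simps)
      then show "(x - z1) * (x - z2) = - (d\<^sup>2 * (sin t)\<^sup>2)" by (simp add: sin_squared_eq algebra_simps)
      show "2 * x - z1 - z2 = 2 * (d * cos t)" unfolding x_def z12 by simp
    qed
    have "poly (pderiv (pderiv p)) x * (d\<^sup>2 * (sin t)\<^sup>2) - poly (pderiv p) x * (d * cos t)
        = - (of_nat (degree p))\<^sup>2 * H t"
      using cheb_like_ode2[OF p c z, of x] unfolding q by (simp add: H_def x_def algebra_simps)
    moreover have "(G has_field_derivative
        poly (pderiv (pderiv p)) x * (d\<^sup>2 * (sin t)\<^sup>2) - poly (pderiv p) x * (d * cos t)) (at t)"
      unfolding G_def x_def
      by (rule derivative_eq_intros refl DERIV_chain2[OF poly_DERIV])+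
        (simp add: power2_eq_square algebra_simps)
    ultimately show ?thesis by simp
  qed
  ultimately have "H (t + 2 * of_real pi / of_nat (degree p)) = H t"
    by (rule harmonic_ode_periodic[OF p])
  then show ?thesis by (simp add: H_def)
qed

section \<open>Towers of common compositions\<close>

text \<open>Points with the same image under \<open>A\<close> have a common partner \<open>b\<close>
  under \<open>B\<close>. Passing through common points transfers membership in \<open>L\<close>
  from one to \<open>b\<close> and from \<open>b\<close> to the other.\<close>

lemma (in composite) vimage_image_eq:
  assumes f: "poly f -` L = E" and g: "poly g -` L = E"
  shows "poly A -` (poly A ` L) = L" "poly B -` (poly A ` L) = L"
proof -
  have fg: "poly f x \<in> L \<longleftrightarrow> poly g x \<in> L" for x using f g by blast
  show "poly A -` (poly A ` L) = L"
  proof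
    show "poly A -` (poly A ` L) \<subseteq> L"
    proof
      fix u assume "u \<in> poly A -` (poly A ` L)"
      then obtain l where l: "l \<in> L" "poly A u = poly A l" by auto
      obtain b where b: "poly B b = poly A u" using poly_surj[OF B_nonconst] by blast
      obtain x where x: "poly f x = u" "poly g x = b" using common_point[of u b] b by metis
      obtain x' where x': "poly f x' = l" "poly g x' = b" using common_point[of l b] b l by metis
      have "b \<in> L" using fg[of x'] x' l by simp
      then show "u \<in> L" using fg[of x] x by simp
    qed
  qed auto
  show "poly B -` (poly A ` L) = L"
  proof (intro equalityI subsetI)
    fix b assume "b \<in> poly B -` (poly A ` L)"
    then obtain l where l: "l \<in> L" "poly B b = poly A l" by auto
    obtain x where x: "poly f x = l" "poly g x = b" using common_point[of l b] l by metis
    show "b \<in> L" using fg[of x] x l by simp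
  next
    fix b assume "b \<in> L"
    obtain x where x: "poly g x = b" using poly_surj[OF g_nonconst] by blast
    have "poly f x \<in> L" using fg[of x] x \<open>b \<in> L\<close> by simp
    moreover have "poly B b = poly A (poly f x)" using comp_eval x by simp
    ultimately show "b \<in> poly B -` (poly A ` L)" by simp
  qed
qed

lemma surj_poly:
  fixes f :: "complex poly"
  assumes "degree f > 0"
  shows "surj (poly f)"
  unfolding surj_def using poly_surj[OF assms] by metis

lemma image_of_vimage:
  fixes f :: "complex poly"
  assumes "degree f > 0" "poly f -` L = K" "compact K" "infinite K"
  shows "compact L" "infinite L"
proof -
  have L: "L = poly f ` K" using surj_image_vimage_eq[OF surj_poly[OF assms(1)], of L] assms(2) by simp
  show "compact L" unfolding L by (intro compact_continuous_image continuous_intros assms)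
  show "infinite L"
  proof
    assume "finite L"
    moreover have "K = (\<Union>u\<in>L. {x. poly f x = u})" using assms(2) by auto
    ultimately have "finite K" using finite_fibre[OF assms(1)] by simp
    with assms(4) show False by simp
  qed
qed

lemma common_composite_locale:
  assumes "compact E" "infinite E" "degree f > 0" "saturated E f" "degree g > 0" "saturated E g"
  obtains A B where "composite f g A B"
  using common_composite[OF assms] assms(3,5) unfolding composite_def by metis

text \<open>Induction on \<open>k\<close> with the set and the pair changing: \<open>L\<close> is
  itself a preimage under both \<open>B\<close> and \<open>A\<close>, so the hypothesis applies to
  \<open>L\<close> and the result is composed with \<open>f\<close>.\<close>

lemma saturated_tower:
  assumes "compact K" "infinite K" "degree f = n" "degree g = m" "n > 0" "m > 0" "coprime n m"
    and "poly f -` L = K" "poly g -` L = K"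
  shows "\<exists>h. degree h = n ^ k \<and> saturated K (pcompose h f)"
  using assms
proof (induction k arbitrary: K f g L)
  case 0
  then show ?case
    using saturated_vimage[of f L] by (intro exI[of _ "[:0, 1:]"]) (simp add: pcompose_pCons)
next
  case (Suc k)
  note f = Suc.prems
  have nc: "degree f > 0" "degree g > 0" using f by auto
  have sat: "saturated K f" "saturated K g" using saturated_vimage f(8,9) by metis+
  obtain A B where "composite f g A B"
    using common_composite_locale[OF f(1,2) nc(1) sat(1) nc(2) sat(2)] by metis
  then interpret coprime_composite f g A B
    using f by (intro coprime_composite.intro coprime_composite_axioms.intro) auto
  have L: "compact L" "infinite L" using image_of_vimage[OF nc(1) f(8,1,2)] by auto
  \<comment> \<open>\<open>B\<close> takes the place of \<open>f\<close> and \<open>A\<close> that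
    of \<open>g\<close>, since \<open>B\<close> has degree \<open>n\<close> and \<open>A\<close> has
    degree \<open>m\<close>.\<close>
  have "\<exists>h. degree h = n ^ k \<and> saturated L (pcompose h B)"
    using vimage_image_eq[OF f(8,9)] L f(3-7) degree_A_eq degree_B_eq by (intro Suc.IH[of L B A]) auto
  then obtain h where h: "degree h = n ^ k" "saturated L (pcompose h B)" by blast
  have "saturated K (pcompose (pcompose h B) f)" by (rule saturated_pcompose[OF h(2) f(8)[symmetric]])
  moreover have "degree (pcompose h B) = n ^ Suc k"
    using h(1) degree_B_eq f(3) by (simp add: degree_pcompose)
  ultimately show ?case by blast
qed

lemma saturated_power_or_cheb_like:
  assumes K: "compact K" "infinite K"
    and p: "saturated K p" "degree p \<ge> 2"
    and q: "saturated K q" "degree q \<ge> 4 * degree p" "coprime (degree p) (degree q)"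
  shows "power_like p \<or> (\<exists>v w. cheb_like p v w)"
proof -
  have "degree p > 0" "degree q > 0" using p q by auto
  then obtain A B where "composite p q A B"
    using common_composite_locale[OF K _ p(1) _ q(1)] by metis
  then interpret coprime_composite p q A B
    using q by (intro coprime_composite.intro coprime_composite_axioms.intro) auto
  show ?thesis using power_or_cheb_like p(2) q(2) by blast
qed

text \<open>The translations by \<open>2\<pi>/N\<close> for unboundedly many \<open>N\<close> generate the translation by \<open>\<pi>\<close> up to
  closure.\<close>

lemma closed_periodic_half_turn:
  fixes c d :: complex and N :: "nat \<Rightarrow> nat"
  assumes "closed K" and N: "filterlim N at_top sequentially"
    and step: "\<And>k t. c + d * cos t \<in> K \<Longrightarrow> c + d * cos (t + 2 * of_real pi / of_nat (N k)) \<in> K"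
    and t: "c + d * cos t \<in> K"
  shows "c - d * cos t \<in> K"
proof -
  have steps: "c + d * cos (t + of_nat j * (2 * of_real pi / of_nat (N k))) \<in> K" for j k
  proof (induction j)
    case (Suc j)
    have "t + of_nat (Suc j) * x = t + of_nat j * x + x" for x by (simp add: algebra_simps)
    from this[of "2 * of_real pi / of_nat (N k)"] show ?case
      using step[OF Suc, of k] by (simp only:)
  qed (simp add: t)
  \<comment> \<open>Half of the \<open>N k\<close> steps, rounded down, make a translation within
    \<open>pi / N k\<close> of \<open>pi\<close>.\<close>
  define r where "r k = real (N k div 2) * (2 * pi / real (N k))" for k
  have r: "c + d * cos (t + of_real (r k)) \<in> K" for k
    using steps[of "N k div 2" k] by (simp add: r_def)
  have "r \<longlonglongrightarrow> pi"
  proof (rule Lim_null_comparison[where g = "\<lambda>k. pi / real (N k)", THEN Lim_null[THEN iffD2]])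
    show "\<forall>\<^sub>F k in sequentially. norm (r k - pi) \<le> pi / real (N k)"
      using filterlim_at_top[THEN iffD1, OF N, THEN spec, of 1]
    proof eventually_elim
      case (elim k)
      have "2 * real (N k div 2) = real (N k) - real (N k mod 2)"
        by (metis add_diff_cancel_right' mult.commute of_nat_add of_nat_mult of_nat_numeral div_mult_mod_eq)
      moreover have "r k - pi = (2 * real (N k div 2) - real (N k)) * (pi / real (N k))"
        using elim by (simp add: r_def field_simps)
      ultimately have "r k - pi = - (pi * real (N k mod 2) / real (N k))" by simp
      then have "norm (r k - pi) = pi * real (N k mod 2) / real (N k)" by simp
      also have "\<dots> \<le> pi * 1 / real (N k)"
        by (intro divide_right_mono mult_left_mono) auto
      finally show ?case by simp
    qed
    have "filterlim (\<lambda>k. real (N k)) at_top sequentially"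
      using filterlim_compose[OF filterlim_real_sequentially N] .
    then show "(\<lambda>k. pi / real (N k)) \<longlonglongrightarrow> 0"
      by (intro tendsto_divide_0[OF tendsto_const] filterlim_at_top_imp_at_infinity)
  qed
  then have lim: "(\<lambda>k. c + d * cos (t + of_real (r k))) \<longlonglongrightarrow> c + d * cos (t + of_real pi)"
    by (intro tendsto_intros)
  have "c + d * cos (t + of_real pi) \<in> K"
    by (rule closed_sequentially[OF assms(1) _ lim]) (use r in auto)
  then show ?thesis by (simp add: cos_add)
qed

lemma point_symmetric_rotation:
  assumes "\<And>z. z \<in> K \<Longrightarrow> 2 * c - z \<in> K"
  shows "\<exists>R. is_rotation R \<and> R \<noteq> id \<and> R ` K = K"
proof -
  define R where "R z = c + exp (\<i> * complex_of_real pi) * (z - c)" for z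
  have R: "R z = 2 * c - z" for z by (simp add: R_def exp_pi_i')
  have "is_rotation R" unfolding is_rotation_def R_def by blast
  moreover have "R (c + 1) \<noteq> id (c + 1)" unfolding R by simp
  then have "R \<noteq> id" by metis
  moreover have "R ` K = K"
  proof
    show "R ` K \<subseteq> K" using assms by (auto simp: R)
    show "K \<subseteq> R ` K"
    proof
      fix z assume "z \<in> K"
      then have "2 * c - z \<in> K" "z = R (2 * c - z)" using assms by (auto simp: R)
      then show "z \<in> R ` K" by blast
    qed
  qed
  ultimately show ?thesis by blast
qed

text \<open>Members of the \<open>n\<close>-tower are compared with much higher members of the
  \<open>m\<close>-tower, which forces each to be power-like or Chebyshev-like. A single power-like
  member suffices; otherwise all members share their special points and the periods tend to
  zero.\<close>

lemma coprime_joint_rotation: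
  assumes K: "compact K" "infinite K" and f: "degree f = n" "n \<ge> 2" and g: "degree g = m" "m \<ge> 2"
    and cop: "coprime n m" and L: "poly f -` L = K" "poly g -` L = K"
  shows "\<exists>R. is_rotation R \<and> R \<noteq> id \<and> R ` K = K"
proof -
  have satf: "saturated K f" using saturated_vimage L(1) by metis
  obtain h where h: "\<And>k. degree (h k) = n ^ k" "\<And>k. saturated K (pcompose (h k) f)"
    using saturated_tower[OF K f(1) g(1) _ _ cop L] f(2) g(2) by (metis gr0I not_numeral_le_zero)
  have deg_hf: "degree (pcompose (h k) f) = n ^ Suc k" for k
    using h(1) f(1) by (simp add: degree_pcompose)
  have ge2: "2 \<le> n ^ Suc k" for k
  proof -
    have "n \<le> n ^ Suc k" by (rule self_le_power) (use f(2) in auto)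
    then show ?thesis using f(2) by linarith
  qed
  have dichotomy: "power_like p \<or> (\<exists>v w. cheb_like p v w)"
    if p: "saturated K p" "degree p = n ^ Suc k" for p k
  proof -
    \<comment> \<open>A height with \<open>m ^ Suc l \<ge> l = 4 * degree p\<close>.\<close>
    define l where "l = 4 * n ^ Suc k"
    obtain q where q: "degree q = m ^ l" "saturated K (pcompose q g)"
      using saturated_tower[OF K g(1) f(1) _ _ _ L(2,1), of l] f(2) g(2) cop by (auto simp: coprime_commute)
    have deg: "degree (pcompose q g) = m ^ Suc l" using q(1) g(1) by (simp add: degree_pcompose)
    have "l \<le> 2 ^ Suc l" by (meson le_trans less_exp less_imp_le lessI)
    also have "\<dots> \<le> m ^ Suc l" using g(2) by (intro power_mono) auto
    finally have "4 * degree p \<le> degree (pcompose q g)" unfolding deg p(2) l_def .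
    moreover have "degree p \<ge> 2" unfolding p(2) by (rule ge2)
    moreover have "coprime (degree p) (degree (pcompose q g))"
      unfolding deg p(2) using cop by simp
    ultimately show ?thesis using saturated_power_or_cheb_like[OF K p(1) _ q(2)] by blast
  qed
  have power_case: ?thesis if p: "saturated K p" "degree p = n ^ Suc k" "power_like p" for p k
    by (rule power_like_rotation[OF p(1,3)]) (unfold p(2), rule ge2)
  show ?thesis
  proof (cases "power_like f \<or> (\<exists>k. power_like (pcompose (h k) f))")
    case True
    then show ?thesis using power_case[OF satf, of 0] power_case[OF h(2) deg_hf] f(1) by auto
  next
    case False
    \<comment> \<open>Quadratic polynomials are power-like, so the degree is now at least 3, as the
      comparison of special points requires.\<close>
    then have "n \<noteq> 2" using degree_2_power_like[of f] f(1) by auto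
    then have n3: "degree f \<ge> 3" using f by simp
    then have f0: "degree f > 0" by simp
    obtain v w where fvw: "cheb_like f v w" using dichotomy[OF satf, of 0] f(1) False by auto
    obtain v' w' where hvw: "\<And>k. cheb_like (pcompose (h k) f) (v' k) (w' k)"
      using dichotomy[OF h(2) deg_hf] False by metis
    obtain z1 z2 where z: "special_points f v w = {z1, z2}" "z1 \<noteq> z2"
      using card_special_points[OF f0 fvw] by (auto simp: card_2_iff)
    have sp: "special_points (pcompose (h k) f) (v' k) (w' k) = {z1, z2}" for k
      using special_points_pcompose[OF n3 fvw _ hvw[of k]] h(1) f(2) z(1) by simp
    define c where "c = (z1 + z2) / 2"
    define d where "d = (z1 - z2) / 2"
    have d0: "d \<noteq> 0" using z(2) by (simp add: d_def)
    have step: "c + d * cos (t + 2 * of_real pi / of_nat (n ^ Suc k)) \<in> K"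
      if "c + d * cos t \<in> K" for k t
    proof -
      have "degree (pcompose (h k) f) > 0" using deg_hf f(2) by simp
      from cheb_like_periodic[OF this hvw sp, of t]
      have "poly (pcompose (h k) f) (c + d * cos (t + 2 * of_real pi / of_nat (n ^ Suc k)))
          = poly (pcompose (h k) f) (c + d * cos t)"
        by (simp only: c_def d_def deg_hf)
      then show ?thesis using h(2)[of k] that unfolding saturated_def by metis
    qed
    have lim: "filterlim (\<lambda>k. n ^ Suc k) at_top sequentially"
    proof (rule filterlim_at_top_mono[OF filterlim_ident])
      show "\<forall>\<^sub>F k in sequentially. k \<le> n ^ Suc k"
      proof (intro always_eventually allI)
        fix k
        have "k \<le> 2 ^ Suc k" by (meson le_trans less_exp less_imp_le lessI)
        also have "\<dots> \<le> n ^ Suc k" using f(2) by (intro power_mono) auto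
        finally show "k \<le> n ^ Suc k" .
      qed
    qed
    have "2 * c - z \<in> K" if "z \<in> K" for z
    proof -
      \<comment> \<open>The complex cosine is surjective, so the coordinate \<open>t\<close> reaches
        every point of the plane.\<close>
      have zt: "z = c + d * cos (Arccos ((z - c) / d))" using d0 by (simp add: cos_Arccos)
      have "c - d * cos (Arccos ((z - c) / d)) \<in> K"
        by (rule closed_periodic_half_turn[OF compact_imp_closed[OF K(1)] lim step])
          (use zt that in auto)
      then show ?thesis using d0 by (simp add: cos_Arccos)
    qed
    then show ?thesis by (rule point_symmetric_rotation)
  qed
qed

section \<open>Affine polynomials\<close>

text \<open>The map scales distances by \<open>norm a\<close>. Mapping a diametral pair forward and
  pulling it back bounds \<open>norm a\<close> from both sides.\<close>

lemma compact_affine_invariant_norm: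
  fixes a b :: complex
  assumes K: "compact K" "infinite K" and a: "a \<noteq> 0"
    and inv: "(\<lambda>z. a * z + b) -` K = K"
  shows "norm a = 1"
proof -
  let ?D = "diameter K"
  have "K \<noteq> {}" using K by auto
  from diameter_compact_attained[OF K(1) this] obtain x y where xy: "x \<in> K" "y \<in> K" "dist x y = ?D"
    by blast
  obtain u v where "u \<in> K" "v \<in> K" "u \<noteq> v"
    using K(2) by (metis finite.emptyI finite_insert finite_subset insertI1 singletonD subsetI)
  then have D: "?D > 0"
    using diameter_bounded_bound[OF compact_imp_bounded[OF K(1)], of u v] by (metis dual_order.strict_trans1 zero_less_dist_iff)
  have bound: "dist u v \<le> ?D" if "u \<in> K" "v \<in> K" for u v
    using diameter_bounded_bound[OF compact_imp_bounded[OF K(1)] that] .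
  have dist: "dist (a * u + b) (a * v + b) = norm a * dist u v" for u v
    by (simp add: dist_norm flip: norm_mult right_diff_distrib)
  have "a * x + b \<in> K" "a * y + b \<in> K" using inv xy by auto
  from bound[OF this] have "norm a * ?D \<le> ?D" by (simp only: dist xy)
  moreover define x' y' where "x' = (x - b) / a" and "y' = (y - b) / a"
  have x': "a * x' + b = x" "a * y' + b = y" using a by (simp_all add: x'_def y'_def)
  then have "x' \<in> K" "y' \<in> K" using inv xy by auto
  then have "dist x y \<le> norm a * ?D"
    using bound[of x' y'] dist[of x' y'] x' by (simp add: mult_left_mono)
  then have "?D \<le> norm a * ?D" using xy by simp
  ultimately have "norm a * ?D = 1 * ?D" by simp
  then show ?thesis using D by simp
qed

text \<open>At a point of \<open>K\<close> furthest in direction \<open>b\<close>, translation by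
  \<open>b\<close> would lead further.\<close>

lemma compact_not_translation_invariant:
  assumes K: "compact K" "K \<noteq> {}" and b: "b \<noteq> (0 :: complex)"
  shows "\<not> (\<forall>z\<in>K. z + b \<in> K)"
proof
  assume inv: "\<forall>z\<in>K. z + b \<in> K"
  have "continuous_on K (\<lambda>z. Re (cnj b * z))" by (intro continuous_intros)
  from continuous_attains_sup[OF K this] obtain z where
    z: "z \<in> K" "\<And>y. y \<in> K \<Longrightarrow> Re (cnj b * y) \<le> Re (cnj b * z)" by blast
  have "Re (cnj b * (z + b)) \<le> Re (cnj b * z)" using z inv by blast
  then have "(Re b)\<^sup>2 + (Im b)\<^sup>2 \<le> 0" by (simp add: power2_eq_square algebra_simps)
  then show False using b by (simp add: sum_power2_le_zero_iff complex_eq_iff)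
qed

lemma affine_invariant_rotation:
  fixes Q :: "complex poly"
  assumes K: "compact K" "infinite K" and Q: "degree Q = 1" "Q \<noteq> [:0, 1:]" "poly Q -` K = K"
  shows "\<exists>R. is_rotation R \<and> R \<noteq> id \<and> R ` K = K"
proof -
  obtain b a where ba: "Q = [:b, a:]" "a \<noteq> 0" using degree1_coeffs[OF Q(1)] by metis
  have Qz: "poly Q z = a * z + b" for z by (simp add: ba algebra_simps)
  have "poly Q = (\<lambda>z. a * z + b)" using Qz by (intro ext)
  then have inv: "(\<lambda>z. a * z + b) -` K = K" using Q(3) by simp
  have norm: "norm a = 1" by (rule compact_affine_invariant_norm[OF K ba(2) inv])
  have "K \<noteq> {}" using K by auto
  have "a \<noteq> 1"
  proof
    assume "a = 1"
    then have "b \<noteq> 0" using Q(2) ba by auto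
    then show False
      using compact_not_translation_invariant[OF K(1) \<open>K \<noteq> {}\<close>] inv \<open>a = 1\<close> by auto
  qed
  \<comment> \<open>The fixed point of \<open>poly Q\<close>, which becomes the centre of the
    rotation.\<close>
  define c where "c = b / (1 - a)"
  have "1 - a \<noteq> 0" using \<open>a \<noteq> 1\<close> by simp
  then have "b = (1 - a) * c" by (simp add: c_def)
  then have Qc: "poly Q z = c + a * (z - c)" for z unfolding Qz by (simp add: algebra_simps)
  have "a = exp (\<i> * complex_of_real (Arg a))" using Arg_eq[OF ba(2)] norm by simp
  then have "is_rotation (poly Q)" unfolding is_rotation_def using Qc by (metis ext)
  moreover have "poly Q (c + 1) \<noteq> id (c + 1)" unfolding Qc using \<open>a \<noteq> 1\<close> by simp
  then have "poly Q \<noteq> id" by metis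
  moreover have "poly Q ` K = K"
  proof -
    have "poly Q ` (poly Q -` K) = K"
      using Q(1) by (intro surj_image_vimage_eq surj_poly) simp
    then show ?thesis using Q(3) by simp
  qed
  ultimately show ?thesis by blast
qed

text \<open>If \<open>A\<close> is affine then \<open>f = Q \<circ> g\<close> for \<open>Q = A\<^sup>-\<^sup>1 \<circ> B\<close>, and \<open>K\<close> is invariant under \<open>Q\<close>.\<close>

lemma affine_left_factor:
  assumes K: "compact K" "infinite K" and comp: "pcompose A f = pcompose B g" and "f \<noteq> g"
    and A: "degree A = 1" and B: "degree B > 0" and L: "poly A -` L = K" "poly B -` L = K"
  shows "julia_like K \<or> (\<exists>R. is_rotation R \<and> R \<noteq> id \<and> R ` K = K)"
proof -
  obtain a0 a1 where a: "A = [:a0, a1:]" "a1 \<noteq> 0" using degree1_coeffs[OF A] by metis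
  define Q where "Q = smult (1 / a1) (B - [:a0:])"
  have AQ: "poly A (poly Q y) = poly B y" for y using a by (simp add: Q_def)
  have degQ: "degree Q = degree B" using a B by (simp add: Q_def)
  have inj: "poly A y = poly A y' \<Longrightarrow> y = y'" for y y' using a by simp
  have "poly f x = poly (pcompose Q g) x" for x
    using inj[of "poly f x" "poly Q (poly g x)"] AQ comp by (metis poly_pcompose)
  then have f: "f = pcompose Q g" by (simp add: fun_eq_iff flip: poly_eq_poly_eq_iff)
  have "poly Q -` K = K"
  proof -
    have "poly Q y \<in> K \<longleftrightarrow> y \<in> K" for y using L AQ[of y] by (metis vimage_eq)
    then show ?thesis by auto
  qed
  moreover have "\<exists>x\<in>K. \<exists>y\<in>K. x \<noteq> y"
    using K(2) by (metis finite.emptyI finite_insert finite_subset insertI1 singletonD subsetI)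
  moreover have "Q \<noteq> [:0, 1:]" using f \<open>f \<noteq> g\<close> by (auto simp: pcompose_pCons)
  ultimately show ?thesis
    using affine_invariant_rotation[OF K, of Q] K(1) degQ B unfolding julia_like_def
    by (cases "degree Q = 1") auto
qed

section \<open>Uniqueness sets\<close>

lemma compact_poly_vimage:
  fixes f :: "complex poly"
  assumes "degree f > 0" "compact K"
  shows "compact (poly f -` K)"
proof -
  obtain r where r: "r > 0" "\<And>z. z \<in> K \<Longrightarrow> norm z \<le> r"
    using compact_imp_bounded[OF assms(2)] unfolding bounded_pos by auto
  have "\<forall>\<^sub>F z in at_infinity. r + 1 \<le> norm (poly f z)"
    using filterlim_poly_at_infinity[of f] assms(1) r(1)
    by (auto simp: filterlim_at_infinity[of 0])
  then obtain b where b: "\<And>z. b \<le> norm z \<Longrightarrow> r + 1 \<le> norm (poly f z)"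
    unfolding eventually_at_infinity by blast
  have "norm z \<le> b" if "z \<in> poly f -` K" for z
    using b[of z] r(2)[of "poly f z"] that by (cases "norm z \<le> b") auto
  then have "bounded (poly f -` K)" unfolding bounded_iff by blast
  moreover have "closed (poly f -` K)"
    using continuous_closed_vimage[OF compact_imp_closed[OF assms(2)], of "poly f"] by simp
  ultimately show ?thesis by (simp add: compact_eq_bounded_closed)
qed

lemma not_uniqueness_julia_or_rotation:
  assumes K: "compact K" "infinite K"
    and f: "degree f > 0" and g: "degree g > 0"
    and eq: "poly f -` K = poly g -` K" and "f \<noteq> g"
  shows "julia_like K \<or> (\<exists>R. is_rotation R \<and> R \<noteq> id \<and> R ` K = K)"
proof -
  define E where "E = poly f -` K"
  have E: "compact E" unfolding E_def by (rule compact_poly_vimage[OF f K(1)])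
  have "poly f ` E = K" unfolding E_def by (intro surj_image_vimage_eq surj_poly f)
  then have infE: "infinite E" using K(2) by auto
  have sat: "saturated E f" "saturated E g"
    using saturated_vimage[of f K] saturated_vimage[of g K] eq by (simp_all add: E_def)
  obtain A B where "composite f g A B"
    using common_composite_locale[OF E infE f sat(1) g sat(2)] by metis
  then interpret composite f g A B .
  have L: "poly A -` (poly A ` K) = K" "poly B -` (poly A ` K) = K"
    by (rule vimage_image_eq[OF E_def[symmetric] eq[folded E_def, symmetric]])+
  define d where "d = gcd (degree f) (degree g)"
  have prod: "lcm (degree f) (degree g) * d = degree f * degree g"
    using prod_gcd_lcm_nat[of "degree f" "degree g"] by (simp only: d_def mult.commute)
  \<comment> \<open>Both composites have the least common multiple as degree, so \<open>A\<close>
    and \<open>B\<close> have the degrees of \<open>g\<close> and \<open>f\<close> divided by their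
    gcd, which are coprime.\<close>
  have "degree f * (degree A * d) = degree f * degree g"
    unfolding prod[symmetric] degree_A[symmetric] by (simp only: mult_ac)
  then have dg: "degree g = degree A * d" using f by (simp only: mult_cancel1) simp
  have "degree g * (degree B * d) = degree g * degree f"
    unfolding mult.commute[of "degree g" "degree f"] prod[symmetric] degree_B[symmetric]
    by (simp only: mult_ac)
  then have df: "degree f = degree B * d" using g by (simp only: mult_cancel1) simp
  have cop: "coprime (degree B) (degree A)"
    using f by (intro gcd_coprime[OF _ df[unfolded d_def] dg[unfolded d_def]]) auto
  consider "degree A = 1" | "degree B = 1" | "degree A \<ge> 2" "degree B \<ge> 2"
    using A_nonconst B_nonconst by linarith
  then show ?thesis
  proof cases
    case 1
    then show ?thesis using affine_left_factor[OF K comp \<open>f \<noteq> g\<close> _ B_nonconst L] by blast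
  next
    case 2
    then show ?thesis
      using affine_left_factor[OF K comp[symmetric] \<open>f \<noteq> g\<close>[symmetric] _ A_nonconst L(2,1)] by blast
  next
    case 3
    then show ?thesis using coprime_joint_rotation[OF K refl _ refl _ cop L(2,1)] by blast
  qed
qed

theorem mainTheorem13:
  fixes K :: "complex set"
  assumes "compact K" and "infinite K"
  shows "uniqueness_set K \<longleftrightarrow>
    \<not> julia_like K \<and> \<not> (\<exists>R. is_rotation R \<and> R \<noteq> id \<and> R ` K = K)"
proof (intro iffI conjI notI)
  assume u: "uniqueness_set K"
  \<comment> \<open>The identity polynomial is the competitor for both a Julia-like \<open>P\<close>
    and a rotation written as a polynomial.\<close>
  have id: "poly [:0, 1:] -` K = K" by auto
  {
    assume "julia_like K"
    then obtain P where P: "degree P \<ge> 2" "poly P -` K = K" by (auto simp: julia_like_def)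
    have "degree P > 0" "degree [:0, 1 :: complex:] > 0" using P(1) by auto
    then have "P = [:0, 1:]" using u P(2) id unfolding uniqueness_set_def by metis
    then show False using P(1) by simp
  }
  {
    assume "\<exists>R. is_rotation R \<and> R \<noteq> id \<and> R ` K = K"
    then obtain c t R where R: "R = (\<lambda>z. c + exp (\<i> * complex_of_real t) * (z - c))" "R \<noteq> id" "R ` K = K"
      by (auto simp: is_rotation_def)
    define e where "e = exp (\<i> * complex_of_real t)"
    have e: "e \<noteq> 0" by (simp add: e_def)
    define g where "g = [:c - e * c, e:]"
    have g: "poly g = R" by (auto simp: g_def R(1) fun_eq_iff e_def algebra_simps)
    have "inj R" using e by (auto simp: R(1) inj_on_def e_def)
    then have "poly g -` K = K" using R(3) g by (metis inj_vimage_image_eq)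
    moreover have "degree g > 0" "degree [:0, 1 :: complex:] > 0" using e by (auto simp: g_def)
    ultimately have "g = [:0, 1:]" using u id unfolding uniqueness_set_def by metis
    then have "R = id" using g by (auto simp: fun_eq_iff)
    then show False using R(2) by simp
  }
next
  assume "\<not> julia_like K \<and> \<not> (\<exists>R. is_rotation R \<and> R \<noteq> id \<and> R ` K = K)"
  then show "uniqueness_set K"
    unfolding uniqueness_set_def using assms not_uniqueness_julia_or_rotation by blast
qed

end
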